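(* Let $n$ be a cube-free positive integer coprime to $3$ having exactly two distinct prime factors $\ell_1$ and $\ell_2$. Then $\operatorname{rk} E_{-432n^2}(\mathbb{Q})=0$, i.e. $n$ is not a sum of two rational cubes, in each of the following cases: (1) $n=\ell_1\ell_2$ or $n=\ell_1^2\ell_2^2$, with $\ell_1\equiv 2 \pmod 9$ and $\ell_2\equiv 5\pmod 9$; (2) $n=\ell_1^2\ell_2$ with $\ell_1\equiv\ell_2\equiv 2\pmod 9$ or $\ell_1\equiv\ell_2\equiv 5\pmod 9$; (3) $n=\ell_1\ell_2$ or $n=\ell_1^2\ell_2$, with $n\equiv 2,5\pmod 9$, where $\ell_1\equiv 1\pmod 3$, $\ell_2\equiv 2\pmod 3$ and $\ell_2$ is not a cube in $\mathbb{F}_{\ell_1}$; (4) $n=\ell_1^2\ell_2^2$ or $n=\ell_1\ell_2^2$, with $n\equiv 4,7\pmod 9$, where $\ell_1\equiv 1\pmod 3$, $\ell_2\equiv 2\pmod 3$ and $\ell_2$ is not a cube in $\mathbb{F}_{\ell_1}$.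
   Context: For an integer $m\neq 0$, $E_m$ denotes the elliptic curve $y^2=x^3+m$ over $\mathbb{Q}$, and $\operatorname{rk} E_m(\mathbb{Q})$ its Mordell–Weil rank. *)

theory Defs
  imports Complex_Main "HOL-Number_Theory.Number_Theory" "HOL-Library.Extended_Nat"
begin

datatype ecpt = Inf | Pt rat rat

definition on_curve :: "int \<Rightarrow> ecpt \<Rightarrow> bool" where
  "on_curve m P = (case P of Inf \<Rightarrow> True | Pt x y \<Rightarrow> y^2 = x^3 + of_int m)"

text \<open>Chord-tangent group law for a short Weierstrass curve y^2 = x^3 + m
  (the formulas do not depend on m since the coefficient of x is 0).\<close>

fun ec_add :: "ecpt \<Rightarrow> ecpt \<Rightarrow> ecpt" where
  "ec_add Inf Q = Q"
| "ec_add P Inf = P"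
| "ec_add (Pt x1 y1) (Pt x2 y2) =
     (if x1 = x2 \<and> y1 = - y2 then Inf
      else (let l = (if x1 = x2 then (3 * x1^2) / (2 * y1) else (y2 - y1) / (x2 - x1));
                x3 = l^2 - x1 - x2
            in Pt x3 (l * (x1 - x3) - y1)))"

fun ec_neg :: "ecpt \<Rightarrow> ecpt" where
  "ec_neg Inf = Inf"
| "ec_neg (Pt x y) = Pt x (- y)"

fun ec_nmul :: "nat \<Rightarrow> ecpt \<Rightarrow> ecpt" where
  "ec_nmul 0 P = Inf"
| "ec_nmul (Suc k) P = ec_add P (ec_nmul k P)"

definition ec_mul :: "int \<Rightarrow> ecpt \<Rightarrow> ecpt" where
  "ec_mul c P = (if c \<ge> 0 then ec_nmul (nat c) P else ec_neg (ec_nmul (nat (- c)) P))"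

definition ec_lincomb :: "int list \<Rightarrow> ecpt list \<Rightarrow> ecpt" where
  "ec_lincomb cs ps = foldr (\<lambda>(c, P) acc. ec_add (ec_mul c P) acc) (zip cs ps) Inf"

definition ec_independent :: "int \<Rightarrow> ecpt list \<Rightarrow> bool" where
  "ec_independent m ps =
     (distinct ps \<and> (\<forall>P\<in>set ps. on_curve m P) \<and>
      (\<forall>cs. length cs = length ps \<longrightarrow> ec_lincomb cs ps = Inf \<longrightarrow> (\<forall>c\<in>set cs. c = 0)))"

definition mw_rank :: "int \<Rightarrow> enat" where
  "mw_rank m = Sup {enat (length ps) | ps. ec_independent m ps}"

end

theory Submission
  imports Defs "HOL-Computational_Algebra.Nth_Powers"
begin

text \<open>An affine point of \<open>y\<^sup>2 = x\<^sup>3 - 432n\<^sup>2\<close> gives \<open>X\<^sup>3 + Y\<^sup>3 = nZ\<^sup>3\<close> with \<open>Z \<noteq> 0\<close>, and this is refuted by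
  descent on \<open>\<bar>Z\<bar>\<close>; so the group of rational points is trivial, not merely finite. For coprime
  \<open>X\<close>, \<open>Y\<close> one has \<open>X + Y = (n/m) a\<^sup>3\<close> and \<open>X\<^sup>2 - XY + Y\<^sup>2 = m b\<^sup>3\<close> up to powers of 3, where \<open>m\<close> is 1 or the
  exact power of \<open>\<ell>\<^sub>1\<close> in \<open>n\<close> (with \<open>\<ell>\<^sub>1 \<equiv> 1\<close> modulo 3), and correspondingly \<open>X + Y\<omega> = \<omega>\<^sup>s \<pi>\<^sup>i \<beta>\<^sup>3\<close>, up to a
  factor \<open>1 - \<omega>\<close>, in \<open>\<int>[\<omega>]\<close>. Congruences modulo 3, and Frobenius at an inert prime, fix \<open>s\<close>.

  If \<open>m \<noteq> 1\<close>, reduce \<open>(X + Y) + \<omega>(X + Y\<omega>) + \<omega>\<^sup>2(X + Y\<omega>\<^sup>2) = 0\<close> modulo \<open>\<pi>\<close>. Choosing \<open>\<pi>\<close> to be a Jacobi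
  sum makes its conjugate a cube modulo \<open>\<pi>\<close>, so \<open>\<ell>\<^sub>2\<close> would be a cube modulo \<open>\<ell>\<^sub>1\<close>. If \<open>m = 1\<close>, then
  \<open>X + Y\<close> becomes a product of three coprime integers with sum zero. Either one of them is
  divisible by \<open>n\<close>, and the three are a smaller solution, or they solve
  \<open>x\<^sup>3 + \<ell>\<^sub>1\<^sup>i y\<^sup>3 + \<ell>\<^sub>2\<^sup>j z\<^sup>3 = 0\<close>, which is impossible modulo 9 or modulo \<open>\<ell>\<^sub>1\<close>.\<close>

section \<open>Eisenstein integers\<close>

definition omega :: complex where "omega = Complex (-1/2) (sqrt 3/2)"

text \<open>Keeping Eisenstein integers inside the complex numbers gives ring laws and conjugation
  for free, while divisibility and congruences are expressed on integer coordinates.\<close>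

definition eis :: "int \<Rightarrow> int \<Rightarrow> complex" where
  "eis x y = of_int x + of_int y * omega"

definition enorm :: "int \<Rightarrow> int \<Rightarrow> int" where
  "enorm x y = x^2 - x*y + y^2"

lemma omega_sq: "omega * omega = - 1 - omega"
  by (simp add: omega_def complex_eq_iff)

lemma cnj_omega: "cnj omega = - 1 - omega"
  by (simp add: omega_def complex_eq_iff)

lemma omega_cube: "omega ^ 3 = 1"
proof -
  have "omega ^ 3 = omega * (omega * omega)" by (simp add: power3_eq_cube)
  also have "\<dots> = 1" by (simp add: omega_sq algebra_simps)
  finally show ?thesis .
qed

lemma eis_mult: "eis a b * eis c d = eis (a*c - b*d) (a*d + b*c - b*d)"
proof -
  have "eis a b * eis c d = of_int (a*c) + of_int (a*d + b*c) * omega + of_int (b*d) * (omega*omega)"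
    by (simp add: eis_def algebra_simps)
  also have "\<dots> = eis (a*c - b*d) (a*d + b*c - b*d)"
    unfolding omega_sq by (simp add: eis_def algebra_simps)
  finally show ?thesis .
qed

lemma eis_add: "eis a b + eis c d = eis (a+c) (b+d)"
  by (simp add: eis_def algebra_simps)

lemma eis_minus: "- eis a b = eis (-a) (-b)"
  by (simp add: eis_def algebra_simps)

lemma eis_cnj: "cnj (eis a b) = eis (a-b) (-b)"
  by (simp add: eis_def cnj_omega algebra_simps)

lemma eis_inject [simp]: "eis a b = eis c d \<longleftrightarrow> a = c \<and> b = d"
proof
  assume "eis a b = eis c d"
  then have "Re (eis a b) = Re (eis c d)" "Im (eis a b) = Im (eis c d)" by auto
  then show "a = c \<and> b = d" by (auto simp: eis_def omega_def)
qed simp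

lemma eis_int: "of_int a = eis a 0"
  by (simp add: eis_def)

lemma eis_omega: "omega = eis 0 1"
  by (simp add: eis_def)

lemma eis_norm: "eis a b * cnj (eis a b) = of_int (enorm a b)"
  by (simp add: eis_cnj eis_mult eis_int enorm_def algebra_simps power2_eq_square)

lemma enorm_conj: "enorm (a-b) (-b) = enorm a b"
  by (simp add: enorm_def algebra_simps power2_eq_square)

lemma enorm_mult: "eis x y = eis a b * eis c d \<Longrightarrow> enorm x y = enorm a b * enorm c d"
  unfolding eis_mult eis_inject enorm_def by (clarify, simp add: algebra_simps power2_eq_square)

text \<open>Completing the square: positivity, the list of units and the divisibility
  \<open>jim_dvd\<close> all rest on it.\<close>

lemma four_enorm: "4 * enorm x y = (2*x - y)^2 + 3 * y^2"
  by (simp add: enorm_def algebra_simps power2_eq_square)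

lemma enorm_nonneg: "enorm x y \<ge> 0"
  using four_enorm[of x y] by (smt (verit) zero_le_power2)

text \<open>Euclid's lemma for a prime \<pi> of norm q, done on coordinates: if q divides the norm
  of \<alpha>, it divides an \<omega>-coordinate of \<alpha> times \<pi> or times its conjugate.
  Then it divides that whole product, and cancelling q leaves the cofactor.\<close>

lemma eis_prime_dvd:
  fixes q :: int
  assumes q: "prime q" and ab: "enorm a b = q" and dvd: "q dvd enorm x y"
  shows "\<exists>c d. eis x y = eis a b * eis c d \<or> eis x y = eis (a-b) (-b) * eis c d"
proof -
  \<comment> \<open>If q divided a, it would divide b too, and q^2 would divide the norm q.\<close>
  have na: "\<not> q dvd a"
  proof
    assume *: "q dvd a"
    have "b^2 = q - a * (a - b)"
      by (simp add: ab[symmetric] enorm_def algebra_simps power2_eq_square)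
    then have "q dvd b^2" using * by simp
    then have "q dvd b" using q prime_dvd_power by blast
    with * obtain a' b' where "a = q * a'" "b = q * b'" by blast
    then have "q * (q * enorm a' b') = q * 1"
      using ab by (simp add: enorm_def algebra_simps power2_eq_square)
    then have "q dvd 1" using q by (metis dvd_triv_left mult_cancel_left not_prime_0)
    then show False using q by (simp add: prime_int_iff)
  qed
  \<comment> \<open>The two factors are the \<omega>-coordinates of
    \<open>eis x y * cnj (eis a b)\<close> and \<open>eis x y * eis a b\<close>.\<close>
  have "(y*a - x*b) * (x*b + y*a - y*b) = y^2 * q - b^2 * enorm x y"
    by (simp add: ab[symmetric] enorm_def algebra_simps power2_eq_square)
  then have "q dvd (y*a - x*b) * (x*b + y*a - y*b)" using dvd by simp
  then consider "q dvd y*a - x*b" | "q dvd x*b + y*a - y*b"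
    using q prime_dvd_mult_iff by blast
  then show ?thesis
  proof cases
    case 1
    have "a * (x*(a-b) + y*b) = x * q + b * (y*a - x*b)"
      by (simp add: ab[symmetric] enorm_def algebra_simps power2_eq_square)
    then have "q dvd a * (x*(a-b) + y*b)" using 1 by simp
    then have "q dvd x*(a-b) + y*b" using na q prime_dvd_mult_iff by blast
    then obtain c where c: "x*(a-b) + y*b = q * c" by blast
    from 1 obtain d where d: "y*a - x*b = q * d" by blast
    \<comment> \<open>Multiplying \<open>q * eis c d\<close>, which is
      \<open>eis x y * cnj (eis a b)\<close>, by \<open>eis a b\<close> and cancelling q recovers
      \<open>eis x y\<close>.\<close>
    have "q * (a*c - b*d) = a * (q*c) - b * (q*d)"
      by (simp add: algebra_simps)
    also have "\<dots> = q * x"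
      unfolding c[symmetric] d[symmetric]
      by (simp add: ab[symmetric] enorm_def algebra_simps power2_eq_square)
    finally have "x = a*c - b*d" using q by auto
    have "q * (a*d + b*c - b*d) = a * (q*d) + b * (q*c) - b * (q*d)"
      by (simp add: algebra_simps)
    also have "\<dots> = q * y"
      unfolding c[symmetric] d[symmetric]
      by (simp add: ab[symmetric] enorm_def algebra_simps power2_eq_square)
    finally have "y = a*d + b*c - b*d" using q by auto
    with \<open>x = _\<close> show ?thesis by (metis eis_mult)
  next
    case 2
    have "(a-b) * (x*a - y*b) = x * q - b * (x*b + y*a - y*b)"
      by (simp add: ab[symmetric] enorm_def algebra_simps power2_eq_square)
    then have "q dvd (a-b) * (x*a - y*b)" using 2 by simp
    moreover have "\<not> q dvd a - b"
    proof
      assume *: "q dvd a - b"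
      have "b^2 = q - a * (a - b)"
        by (simp add: ab[symmetric] enorm_def algebra_simps power2_eq_square)
      then have "q dvd b^2" using * by simp
      then have "q dvd b" using q prime_dvd_power by blast
      then show False using * na by (metis diff_add_cancel dvd_add)
    qed
    ultimately have "q dvd x*a - y*b" using q prime_dvd_mult_iff by blast
    then obtain c where c: "x*a - y*b = q * c" by blast
    from 2 obtain d where d: "x*b + y*a - y*b = q * d" by blast
    have "q * ((a-b)*c - (-b)*d) = (a-b) * (q*c) + b * (q*d)"
      by (simp add: algebra_simps)
    also have "\<dots> = q * x"
      unfolding c[symmetric] d[symmetric]
      by (simp add: ab[symmetric] enorm_def algebra_simps power2_eq_square)
    finally have "x = (a-b)*c - (-b)*d" using q by auto
    have "q * ((a-b)*d + (-b)*c - (-b)*d) = (a-b) * (q*d) - b * (q*c) + b * (q*d)"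
      by (simp add: algebra_simps)
    also have "\<dots> = q * y"
      unfolding c[symmetric] d[symmetric]
      by (simp add: ab[symmetric] enorm_def algebra_simps power2_eq_square)
    finally have "y = (a-b)*d + (-b)*c - (-b)*d" using q by auto
    with \<open>x = _\<close> show ?thesis by (metis eis_mult)
  qed
qed

lemma eis_dvd_coprime:
  assumes "eis x y = of_int c * eis u v" "coprime x y"
  shows "is_unit c"
proof -
  have "x = c*u" "y = c*v" using assms(1) by (simp_all add: eis_int eis_mult)
  then show ?thesis using assms(2) by (meson coprime_common_divisor dvd_triv_left)
qed

lemma eis_power_ex: "\<exists>u v. eis a b ^ k = eis u v"
  by (induction k) (auto simp: eis_mult, (metis eis_int of_int_1))

lemma enorm_power: "eis a b ^ k = eis u v \<Longrightarrow> enorm u v = enorm a b ^ k"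
proof (induction k arbitrary: u v)
  case 0
  then have "eis u v = eis 1 0" by (metis eis_int of_int_1 power_0)
  then show ?case by (simp add: enorm_def)
next
  case (Suc k)
  obtain u' v' where *: "eis a b ^ k = eis u' v'" using eis_power_ex by blast
  then have "eis u v = eis a b * eis u' v'" using Suc.prems by simp
  then show ?case using enorm_mult Suc.IH[OF *] by auto
qed

lemma coprime_eis_factor:
  assumes "eis x y = eis a b * eis u v" "coprime x y"
  shows "coprime u v"
proof (rule coprimeI)
  fix c assume "c dvd u" "c dvd v"
  moreover have "x = a*u - b*v" "y = a*v + b*u - b*v" using assms(1) by (simp_all add: eis_mult)
  ultimately have "c dvd x" "c dvd y" by simp_all
  then show "is_unit c" using assms(2) coprime_common_divisor by blast
qed

text \<open>A prime above q and its conjugate cannot both divide, since their product q would then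
  divide the coprime coordinates. So all k factors can be taken equal; this stands in for unique
  factorization.\<close>

lemma eis_prime_power_dvd:
  fixes q :: int
  assumes q: "prime q" and ab: "enorm a b = q" and cop: "coprime x y"
    and dvd: "q ^ k dvd enorm x y"
  shows "\<exists>c d u v. (c = a \<and> d = b \<or> c = a - b \<and> d = - b) \<and> eis x y = eis c d ^ k * eis u v"
  using dvd
proof (induction k)
  case 0
  then show ?case by auto
next
  case (Suc k)
  then have "q ^ k dvd enorm x y" by (metis dvd_mult_right power_Suc)
  then obtain c d u v where cd: "c = a \<and> d = b \<or> c = a - b \<and> d = - b"
    and eq: "eis x y = eis c d ^ k * eis u v" using Suc.IH by blast
  have N: "enorm c d = q" using cd ab enorm_conj by auto
  obtain s t where st: "eis c d ^ k = eis s t" using eis_power_ex by blast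
  have "enorm x y = q ^ k * enorm u v"
    using enorm_mult[of x y s t u v] enorm_power[OF st] eq st N by simp
  with Suc.prems have "q dvd enorm u v" using q by (auto simp: mult.commute)
  from eis_prime_dvd[OF q N this] obtain e f where
    "eis u v = eis c d * eis e f \<or> eis u v = eis (c-d) (-d) * eis e f" by blast
  then show ?case
  proof
    assume "eis u v = eis c d * eis e f"
    then have "eis x y = eis c d ^ Suc k * eis e f" using eq by simp
    then show ?thesis using cd by blast
  next
    assume *: "eis u v = eis (c-d) (-d) * eis e f"
    show ?thesis
    proof (cases k)
      \<comment> \<open>With no factor extracted yet, the choice between the two conjugate primes is
        still free.\<close>
      case 0
      then have "eis x y = eis (c-d) (-d) ^ Suc k * eis e f" using eq * by simp
      moreover have "c - d = a \<and> - d = b \<or> c - d = a - b \<and> - d = - b" using cd by auto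
      ultimately show ?thesis by blast
    next
      case (Suc k')
      obtain s' t' where st': "eis c d ^ k' = eis s' t'" using eis_power_ex by blast
      have "eis x y = (eis c d * cnj (eis c d)) * (eis c d ^ k' * eis e f)"
        using eq * Suc by (simp add: eis_cnj)
      also have "\<dots> = of_int q * (eis s' t' * eis e f)" using eis_norm N st' by simp
      finally have "is_unit q" using eis_dvd_coprime cop unfolding eis_mult by blast
      then show ?thesis using q by (simp add: prime_int_iff)
    qed
  qed
qed

text \<open>Completing the square in each coordinate leaves the six units; as -1 is a cube, each is
  a power of \<omega> times the cube of 1 or -1.\<close>

lemma eis_unit:
  assumes "enorm x y = 1"
  shows "\<exists>s u. s < 3 \<and> eis x y = omega ^ s * eis u 0 ^ 3"
proof -
  have "(2*x-y)^2 + 3*y^2 = 4" using assms four_enorm[of x y] by simp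
  then have "y^2 \<le> 1" by (smt (verit) zero_le_power2)
  then have "\<bar>y\<bar> \<le> 1" by (metis abs_le_square_iff abs_1 one_power2)
  moreover have "4 * enorm y x = (2*y-x)^2 + 3*x^2" by (rule four_enorm)
  then have "(2*y-x)^2 + 3*x^2 = 4" using assms by (simp add: enorm_def algebra_simps)
  then have "x^2 \<le> 1" by (smt (verit) zero_le_power2)
  then have "\<bar>x\<bar> \<le> 1" by (metis abs_le_square_iff abs_1 one_power2)
  ultimately have "x \<in> {-1,0,1}" "y \<in> {-1,0,1}" by auto
  with assms have "(x,y) \<in> {(1,0),(-1,0),(0,1),(0,-1),(1,1),(-1,-1)}" by (auto simp: enorm_def)
  moreover have "\<exists>s u. s < (3::nat) \<and> eis 1 0 = omega ^ s * eis u 0 ^ 3"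
    by (rule exI[of _ 0], rule exI[of _ "1"])
      (simp add: eis_omega power3_eq_cube power2_eq_square eis_mult)
  moreover have "\<exists>s u. s < (3::nat) \<and> eis (-1) 0 = omega ^ s * eis u 0 ^ 3"
    by (rule exI[of _ 0], rule exI[of _ "-1"])
      (simp add: eis_omega power3_eq_cube power2_eq_square eis_mult)
  moreover have "\<exists>s u. s < (3::nat) \<and> eis 0 1 = omega ^ s * eis u 0 ^ 3"
    by (rule exI[of _ 1], rule exI[of _ "1"])
      (simp add: eis_omega power3_eq_cube power2_eq_square eis_mult)
  moreover have "\<exists>s u. s < (3::nat) \<and> eis 0 (-1) = omega ^ s * eis u 0 ^ 3"
    by (rule exI[of _ 1], rule exI[of _ "-1"])
      (simp add: eis_omega power3_eq_cube power2_eq_square eis_mult)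
  moreover have "\<exists>s u. s < (3::nat) \<and> eis 1 1 = omega ^ s * eis u 0 ^ 3"
    by (rule exI[of _ 2], rule exI[of _ "-1"])
      (simp add: eis_omega power3_eq_cube power2_eq_square eis_mult)
  moreover have "\<exists>s u. s < (3::nat) \<and> eis (-1) (-1) = omega ^ s * eis u 0 ^ 3"
    by (rule exI[of _ 2], rule exI[of _ "1"])
      (simp add: eis_omega power3_eq_cube power2_eq_square eis_mult)
  ultimately show ?thesis by auto
qed

section \<open>Jacobi sums of the cubic residue character\<close>

lemma fermat_int:
  fixes q :: nat and x :: int
  assumes q: "prime q" and x: "\<not> int q dvd x"
  shows "[x ^ (q - 1) = 1] (mod int q)"
proof -
  define y where "y = nat (x mod int q)"
  have y: "int y = x mod int q" using prime_gt_0_nat[OF q] by (simp add: y_def)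
  then have "\<not> int q dvd int y" using x by (simp add: dvd_mod_iff)
  then have "\<not> q dvd y" by simp
  then have "[y ^ (q-1) = 1] (mod q)" by (rule fermat_theorem[OF q])
  then have "[int (y ^ (q-1)) = int 1] (mod int q)" by (simp only: cong_int_iff)
  then have "[(x mod int q) ^ (q-1) = 1] (mod int q)" by (simp add: y)
  then show ?thesis by (simp add: cong_def power_mod)
qed

text \<open>An affine map permutes the residues; periodicity of f spares reducing its argument
  modulo P.\<close>

lemma sum_affine_mod:
  fixes f :: "int \<Rightarrow> 'a::comm_monoid_add" and P :: int
  assumes P: "prime P" and a: "\<not> P dvd a"
    and per: "\<And>x y. [x = y] (mod P) \<Longrightarrow> f x = f y"
  shows "(\<Sum>x\<in>{0..<P}. f (a * x + b)) = (\<Sum>x\<in>{0..<P}. f x)"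
proof -
  let ?h = "\<lambda>x. (a * x + b) mod P"
  have pos: "P > 0" using P by (simp add: prime_gt_0_int)
  have "inj_on ?h {0..<P}"
  proof (rule inj_onI)
    fix x y assume xy: "x \<in> {0..<P}" "y \<in> {0..<P}" "?h x = ?h y"
    then have "P dvd (a * x + b) - (a * y + b)" by (simp add: mod_eq_dvd_iff)
    then have "P dvd a * (x - y)" by (simp add: algebra_simps)
    then have "P dvd x - y" using P a prime_dvd_mult_iff by blast
    then have "x mod P = y mod P" by (simp add: mod_eq_dvd_iff)
    then show "x = y" using xy by simp
  qed
  moreover have "?h ` {0..<P} \<subseteq> {0..<P}" using pos by auto
  ultimately have "bij_betw ?h {0..<P} {0..<P}"
    by (metis bij_betw_def endo_inj_surj finite_atLeastLessThan_int)
  then have "(\<Sum>x\<in>{0..<P}. f (?h x)) = (\<Sum>x\<in>{0..<P}. f x)"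
    by (rule sum.reindex_bij_betw)
  moreover have "f (?h x) = f (a * x + b)" for x
    by (rule per) (simp add: cong_def)
  ultimately show ?thesis by simp
qed

lemma modular_inverse_bij:
  fixes P :: int
  assumes P: "prime P"
  shows "bij_betw (modular_inverse P) {1..<P} {1..<P}"
proof -
  have cop: "coprime x P" if "x \<in> {1..<P}" for x
  proof -
    have "\<not> P dvd x" using that by (auto dest: zdvd_imp_le)
    then show ?thesis using P by (simp add: prime_imp_coprime coprime_commute)
  qed
  have gt: "P > 1" using P by (simp add: prime_gt_1_int)
  have "inj_on (modular_inverse P) {1..<P}"
  proof (rule inj_onI)
    fix x y assume xy: "x \<in> {1..<P}" "y \<in> {1..<P}" "modular_inverse P x = modular_inverse P y"
    have "[x * (modular_inverse P x * y) = x * 1] (mod P)"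
      using xy cong_modular_inverse2[OF cop[of y]] by (intro cong_mult) auto
    moreover have "[(x * modular_inverse P x) * y = 1 * y] (mod P)"
      by (intro cong_mult cong_modular_inverse1 cop xy cong_refl)
    ultimately have "[x = y] (mod P)"
      by (metis cong_sym cong_trans mult.assoc mult.left_neutral mult.right_neutral)
    then show "x = y" using xy by (simp add: cong_def)
  qed
  moreover have "modular_inverse P ` {1..<P} \<subseteq> {1..<P}"
  proof safe
    fix x assume x: "x \<in> {1..<P}"
    show "modular_inverse P x \<in> {1..<P}"
      using mult_modular_inverse_int_pos[OF gt cop[OF x]] modular_inverse_int_less[of P x] gt by auto
  qed
  ultimately show ?thesis
    by (metis bij_betw_def endo_inj_surj finite_atLeastLessThan_int)
qed

section \<open>The cubic residue character modulo p\<close>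

locale cubic_residues =
  fixes p k :: nat and g :: int
  assumes prime_p: "prime p" and p_eq: "p = 3 * k + 1"
    and g_order: "\<And>d. [g ^ d = 1] (mod int p) \<longleftrightarrow> 3 * k dvd d"
begin

abbreviation "P \<equiv> int p"
text \<open>By \<open>g_order\<close>, g is a primitive root, so this is a primitive cube root of
  unity modulo p: the image of \<omega> in the residue field of a prime above p.\<close>

definition "theta = g ^ k"

lemma k_pos: "k > 0" using prime_p p_eq by (cases k) auto
lemma P_prime: "prime P" using prime_p by simp
lemma P_gt_1: "P > 1" by (rule prime_gt_1_int[OF P_prime])

text \<open>Settles signs: \<open>chi (-1) = 1\<close>, and the factors \<open>(-1) ^ k\<close> in
  the binomial expansion and in Wilson's theorem.\<close>

lemma k_even: "even k"
proof (rule ccontr)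
  assume "odd k"
  then have "even p" using p_eq by simp
  then have "p = 2" using prime_p prime_odd_nat[of p] prime_ge_2_nat[of p] by fastforce
  then show False using p_eq by presburger
qed

lemma g_ndvd: "\<not> P dvd g"
proof
  assume "P dvd g"
  then have "P dvd g ^ (3*k)" using k_pos dvd_trans[OF _ dvd_power[of "3*k" g]] by simp
  moreover have "[g ^ (3*k) = 1] (mod P)" using g_order by simp
  ultimately have "P dvd 1" using cong_dvd_iff by blast
  then show False using P_gt_1 by auto
qed

lemma theta_cube: "[theta ^ 3 = 1] (mod P)"
  using g_order[of "k*3"] by (simp add: theta_def power_mult[symmetric] mult.commute)

lemma theta_neq_1: "\<not> [theta = 1] (mod P)"
  using g_order[of k] k_pos by (auto simp: theta_def dest: dvd_imp_le)

lemma theta_sum: "P dvd theta^2 + theta + 1"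
proof -
  have "P dvd theta^3 - 1" using theta_cube by (simp add: cong_iff_dvd_diff)
  also have "theta^3 - 1 = (theta - 1) * (theta^2 + theta + 1)"
    by (simp add: algebra_simps power2_eq_square power3_eq_cube)
  finally show ?thesis using theta_neq_1 P_prime
    by (simp add: cong_iff_dvd_diff prime_dvd_mult_iff)
qed

lemma theta_sq_neq_1: "\<not> [theta^2 = 1] (mod P)"
proof
  assume "[theta^2 = 1] (mod P)"
  then have "[theta^2 * theta = 1 * theta] (mod P)" by (intro cong_mult cong_refl)
  then have "[theta^3 = theta] (mod P)" by (simp add: power3_eq_cube power2_eq_square)
  then show False using theta_cube theta_neq_1 cong_sym cong_trans by blast
qed

lemma theta_sq_neq_theta: "\<not> [theta^2 = theta] (mod P)"
proof
  assume "[theta^2 = theta] (mod P)"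
  then have "[theta^2 * theta = theta * theta] (mod P)" by (intro cong_mult cong_refl)
  then have "[theta^3 = theta^2] (mod P)" by (simp add: power3_eq_cube power2_eq_square)
  then show False using theta_cube theta_sq_neq_1 cong_sym cong_trans by blast
qed

lemma fermat: "\<not> P dvd x \<Longrightarrow> [x ^ (3*k) = 1] (mod P)"
  using fermat_int[OF prime_p] p_eq by simp

text \<open>By Fermat \<open>x ^ k\<close> is a root of T^3 - 1, which splits modulo p as (T - 1)(T
  - theta)(T - theta^2).\<close>

lemma power_k_cases:
  assumes "\<not> P dvd x"
  obtains e where "e < 3" "[x ^ k = theta ^ e] (mod P)"
proof -
  let ?y = "x ^ k"
  have 1: "P dvd ?y^3 - 1" using fermat[OF assms]
    by (simp add: cong_iff_dvd_diff power_mult[symmetric] mult.commute)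
  obtain c where c: "theta^2 + theta + 1 = P * c" using theta_sum by blast
  \<comment> \<open>The product differs from \<open>?y^3 - 1\<close> only by multiples of
    \<open>theta^2 + theta + 1\<close>.\<close>
  have "(?y - 1) * (?y - theta) * (?y - theta^2) =
     (?y^3 - 1) - (theta^2 + theta + 1) * ?y^2 + (theta^2 + theta + 1) * theta * ?y - (theta - 1) * (theta^2 + theta + 1)"
    by (simp add: algebra_simps power2_eq_square power3_eq_cube)
  also have "P dvd \<dots>" by (rule dvd_diff[OF dvd_add[OF dvd_diff[OF 1 dvd_mult2[OF theta_sum]]
      dvd_mult2[OF dvd_mult2[OF theta_sum]]] dvd_mult[OF theta_sum]])
  finally have "P dvd ?y - 1 \<or> P dvd ?y - theta \<or> P dvd ?y - theta^2"
    using P_prime by (simp add: prime_dvd_mult_iff)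
  then have "[x ^ k = theta ^ 0] (mod P) \<or> [x ^ k = theta ^ 1] (mod P) \<or> [x ^ k = theta ^ 2] (mod P)"
    by (simp add: cong_iff_dvd_diff)
  then show ?thesis using that[of 0] that[of 1] that[of 2] by auto
qed

text \<open>The character of \<open>x\<close> is \<open>\<omega>\<^sup>e\<close> where \<open>x\<^sup>k \<equiv> \<theta>\<^sup>e\<close>, and 0 if \<open>p\<close> divides \<open>x\<close>. Its coordinates \<open>re\<close>, \<open>im\<close>
  with respect to \<open>1, \<omega>\<close> are kept as integers, so that it can also be reduced modulo \<open>p\<close>.\<close>

definition re :: "int \<Rightarrow> int" where
  "re x = (if P dvd x then 0 else if [x ^ k = 1] (mod P) then 1
     else if [x ^ k = theta] (mod P) then 0 else -1)"

definition im :: "int \<Rightarrow> int" where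
  "im x = (if P dvd x then 0 else if [x ^ k = 1] (mod P) then 0
     else if [x ^ k = theta] (mod P) then 1 else -1)"

definition chi :: "int \<Rightarrow> complex" where "chi x = eis (re x) (im x)"

lemma cong_trans_left: "[a = b] (mod m) \<Longrightarrow> [a = c] (mod m) \<Longrightarrow> [b = (c::int)] (mod m)"
  using cong_sym cong_trans by blast

lemma chi_values:
  assumes "\<not> P dvd x"
  shows "[x ^ k = 1] (mod P) \<Longrightarrow> re x = 1 \<and> im x = 0"
    "[x ^ k = theta] (mod P) \<Longrightarrow> re x = 0 \<and> im x = 1"
    "[x ^ k = theta^2] (mod P) \<Longrightarrow> re x = -1 \<and> im x = -1"
  using assms theta_neq_1 theta_sq_neq_1 theta_sq_neq_theta
  unfolding re_def im_def by (auto dest: cong_trans_left)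

lemma chi_eqI:
  assumes x: "\<not> P dvd x" and e: "[x ^ k = theta ^ e] (mod P)"
  shows "chi x = omega ^ e"
proof -
  have "e = 3 * (e div 3) + e mod 3" by simp
  then have *: "theta ^ e = (theta ^ 3) ^ (e div 3) * theta ^ (e mod 3)"
    and **: "omega ^ e = (omega ^ 3) ^ (e div 3) * omega ^ (e mod 3)"
    by (metis power_add power_mult)+
  have "[theta ^ e = 1 ^ (e div 3) * theta ^ (e mod 3)] (mod P)"
    unfolding * by (intro cong_mult cong_pow theta_cube cong_refl)
  with e have ee: "[x ^ k = theta ^ (e mod 3)] (mod P)" using cong_trans by fastforce
  have "omega ^ e = omega ^ (e mod 3)" unfolding ** by (simp add: omega_cube)
  moreover have "chi x = omega ^ (e mod 3)"
  proof -
    consider "e mod 3 = 0" | "e mod 3 = 1" | "e mod 3 = 2" by linarith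
    then show ?thesis
    proof cases
      case 1 then show ?thesis using chi_values(1)[OF x] ee by (simp add: chi_def eis_def)
    next
      case 2 then show ?thesis using chi_values(2)[OF x] ee by (simp add: chi_def eis_def)
    next
      case 3 then show ?thesis using chi_values(3)[OF x] ee
        by (simp add: chi_def eis_def power2_eq_square omega_sq)
    qed
  qed
  ultimately show ?thesis by simp
qed

lemma chi_0: "P dvd x \<Longrightarrow> chi x = 0" by (simp add: chi_def re_def im_def eis_def)

lemma chi_mult: "chi (x * y) = chi x * chi y"
proof (cases "P dvd x \<or> P dvd y")
  case True
  then show ?thesis using chi_0[of x] chi_0[of y] chi_0[of "x*y"] by auto
next
  case False
  then obtain e f where e: "[x ^ k = theta ^ e] (mod P)" and f: "[y ^ k = theta ^ f] (mod P)"
    using power_k_cases by metis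
  have "[(x*y) ^ k = theta ^ (e + f)] (mod P)"
    using cong_mult[OF e f] by (simp add: power_mult_distrib power_add)
  moreover have "\<not> P dvd x * y" using False P_prime by (simp add: prime_dvd_mult_iff)
  ultimately have "chi (x * y) = omega ^ (e + f)" by (intro chi_eqI)
  then show ?thesis using chi_eqI[OF _ e] chi_eqI[OF _ f] False by (simp add: power_add)
qed

lemma chi_cong: "[x = y] (mod P) \<Longrightarrow> chi x = chi y"
proof -
  assume xy: "[x = y] (mod P)"
  then have "P dvd x \<longleftrightarrow> P dvd y" by (rule cong_dvd_iff)
  moreover have "[x ^ k = c] (mod P) \<longleftrightarrow> [y ^ k = c] (mod P)" for c
    using cong_pow[OF xy, of k] by (metis cong_sym cong_trans)
  ultimately show ?thesis by (simp add: chi_def re_def im_def)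
qed

lemma chi_1: "chi 1 = 1" using chi_eqI[of 1 0] P_gt_1 by auto

lemma chi_minus_1: "chi (-1) = 1" using chi_eqI[of "-1" 0] P_gt_1 k_even by auto

lemma chi_cube: "\<not> P dvd x \<Longrightarrow> chi x * chi x * chi x = 1"
proof -
  assume x: "\<not> P dvd x"
  obtain e where e: "[x ^ k = theta ^ e] (mod P)" using power_k_cases[OF x] by metis
  have "chi x * chi x * chi x = (omega ^ e) ^ 3" by (simp add: chi_eqI[OF x e] power3_eq_cube)
  also have "\<dots> = (omega ^ 3) ^ e" by (simp add: power_mult[symmetric] mult.commute)
  finally show ?thesis by (simp add: omega_cube)
qed

lemma cnj_chi: "cnj (chi x) = chi (x * x)"
proof (cases "P dvd x")
  case False
  obtain e where e: "[x ^ k = theta ^ e] (mod P)" using power_k_cases[OF False] by metis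
  have "cnj omega = omega * omega" by (simp add: cnj_omega omega_sq)
  then show ?thesis by (simp add: chi_mult chi_eqI[OF False e] power_mult_distrib)
qed (simp add: chi_0)

text \<open>The reductions of \<open>chi\<close> modulo the two primes above p, given by \<omega>
  \<mapsto> theta and \<omega> \<mapsto> theta^2; they turn character sums into power sums.\<close>

lemma chi_reduce:
  "[x ^ k = re x + im x * theta] (mod P)" "[x ^ (2*k) = re x + im x * theta^2] (mod P)"
proof -
  have A: "[x ^ k = re x + im x * theta] (mod P) \<and> [x ^ (2*k) = re x + im x * theta^2] (mod P)"
  proof (cases "P dvd x")
    case True
    then have "P dvd x ^ k" "P dvd x ^ (2*k)"
      using k_pos dvd_trans[OF True dvd_power[of _ x]] by simp_all
    then show ?thesis using True by (simp add: re_def im_def cong_0_iff)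
  next
    case False
    obtain e where e: "e < 3" "[x ^ k = theta ^ e] (mod P)" using power_k_cases[OF False] by metis
    have e2: "[x ^ (2*k) = (theta ^ e)^2] (mod P)"
      using cong_pow[OF e(2), of 2] by (simp add: power_mult[symmetric] mult.commute)
    consider "e = 0" | "e = 1" | "e = 2" using e(1) by linarith
    then show ?thesis
    proof cases
      case 1 then show ?thesis using chi_values(1)[OF False] e e2 by simp
    next
      case 2 then show ?thesis using chi_values(2)[OF False] e e2 by simp
    next
      case 3
      have "[theta^2 = -1 + -1 * theta] (mod P)" using theta_sum
        by (simp add: cong_iff_dvd_diff algebra_simps)
      moreover have "[(theta^2)^2 = -1 + -1 * theta^2] (mod P)"
      proof -
        have "(theta^2)^2 - (-1 + -1 * theta^2) = (theta^2 + theta + 1) * (theta^2 - theta + 1)"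
          by (simp add: algebra_simps power2_eq_square)
        then show ?thesis using theta_sum by (simp add: cong_iff_dvd_diff)
      qed
      ultimately show ?thesis using 3 chi_values(3)[OF False] e e2 cong_trans by fastforce
    qed
  qed
  show "[x ^ k = re x + im x * theta] (mod P)" "[x ^ (2*k) = re x + im x * theta^2] (mod P)"
    using A by auto
qed

text \<open>Substituting g x for x multiplies the sum by \<open>chi g = omega\<close>, which is not
  1.\<close>

lemma sum_chi: "(\<Sum>x\<in>{0..<P}. chi x) = 0"
proof -
  let ?S = "\<Sum>x\<in>{0..<P}. chi x"
  have "?S = (\<Sum>x\<in>{0..<P}. chi (g * x + 0))"
    by (rule sum_affine_mod[symmetric]) (use P_prime g_ndvd chi_cong in auto)
  also have "\<dots> = chi g * ?S" by (simp add: chi_mult sum_distrib_left)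
  finally have "?S = chi g * ?S" .
  moreover have "chi g = omega" using chi_eqI[OF g_ndvd, of 1] by (simp add: theta_def)
  moreover have "omega \<noteq> 1" by (simp add: omega_def complex_eq_iff)
  ultimately show ?thesis by (metis mult_cancel_right1)
qed

lemma sum_remove_0: "(\<Sum>x\<in>{0..<P}. f x) = f 0 + (\<Sum>x\<in>{1..<P}. f x)" for f :: "int \<Rightarrow> complex"
proof -
  have "{0..<P} = insert 0 {1..<P}" using P_gt_1 by auto
  then show ?thesis by simp
qed

lemma ndvd: "x \<in> {1..<P} \<Longrightarrow> \<not> P dvd x" by (auto dest: zdvd_imp_le)

lemma sum_chi_affine: "\<not> P dvd c \<Longrightarrow> (\<Sum>x\<in>{0..<P}. chi (c * x + d)) = 0"
  using sum_affine_mod[of P c chi d] P_prime chi_cong sum_chi by auto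

text \<open>Since w^3 has character 1, each term is the character of c/w + d. As 1/w runs over the
  nonzero residues, a vanishing affine sum lacking its term at 0 remains.\<close>

lemma sum_chi_cubic:
  assumes c: "\<not> P dvd c"
  shows "(\<Sum>w\<in>{1..<P}. chi ((c + d * w) * (w * w))) = - chi d"
proof -
  let ?i = "modular_inverse P"
  have "chi ((c + d * w) * (w * w)) = chi (c * ?i w + d)" if w: "w \<in> {1..<P}" for w
  proof -
    have "coprime w P" using ndvd[OF w] P_prime by (metis coprime_commute prime_imp_coprime)
    then have i: "[w * ?i w = 1] (mod P)" by (rule cong_modular_inverse1)
    have "[(c * (w * ?i w) + d * w) * (w * w) = (c * 1 + d * w) * (w * w)] (mod P)"
      by (intro cong_mult cong_add cong_refl i)
    then have "chi ((c + d * w) * (w * w)) = chi ((c * ?i w + d) * (w * w * w))"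
      by (intro chi_cong) (simp add: cong_sym algebra_simps)
    also have "\<dots> = chi (c * ?i w + d)" using chi_cube[OF ndvd[OF w]] by (simp add: chi_mult)
    finally show ?thesis .
  qed
  then have "(\<Sum>w\<in>{1..<P}. chi ((c + d * w) * (w * w))) = (\<Sum>w\<in>{1..<P}. chi (c * ?i w + d))"
    by simp
  also have "\<dots> = (\<Sum>z\<in>{1..<P}. chi (c * z + d))"
    by (rule sum.reindex_bij_betw[OF modular_inverse_bij[OF P_prime]])
  also have "\<dots> = - chi d" using sum_chi_affine[OF c, of d] sum_remove_0[of "\<lambda>z. chi (c * z + d)"]
    by (simp add: add_eq_0_iff)
  finally show ?thesis .
qed

section \<open>The Jacobi sum J(chi, chi), its norm, and its trace modulo 9\<close>

definition "jacobi = (\<Sum>x\<in>{0..<P}. chi (x * (1 - x)))"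
definition "jre = (\<Sum>x\<in>{0..<P}. re (x * (1 - x)))"
definition "jim = (\<Sum>x\<in>{0..<P}. im (x * (1 - x)))"

lemma jacobi_eis: "jacobi = eis jre jim"
  by (simp add: jacobi_def jre_def jim_def chi_def eis_def sum.distrib sum_distrib_right)

lemma sum_chi_sq: "(\<Sum>x\<in>{0..<P}. chi x * chi x) = 0"
proof -
  have "(\<Sum>x\<in>{0..<P}. chi x * chi x) = cnj (\<Sum>x\<in>{0..<P}. chi x)"
    by (simp add: cnj_chi chi_mult)
  then show ?thesis by (simp add: sum_chi)
qed

text \<open>The substitution y = 1 - w leads to \<open>sum_chi_cubic\<close>; for s = 1 all terms
  with w nonzero are 1.\<close>

lemma jacobi_inner_sum:
  assumes s: "s \<in> {0..<P}"
  shows "(\<Sum>y\<in>{1..<P}. chi ((1 - s * y) * ((1 - y) * (1 - y))))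
    = - chi s - 1 + (if s = 1 then of_int P else 0)"
proof -
  let ?G = "\<lambda>y. chi ((1 - s * y) * ((1 - y) * (1 - y)))"
  have "(\<Sum>y\<in>{0..<P}. ?G y) = (\<Sum>w\<in>{0..<P}. ?G ((-1) * w + 1))"
  proof (rule sum_affine_mod[symmetric])
    show "\<not> P dvd -1" using P_gt_1 by auto
    show "?G x = ?G y" if "[x = y] (mod P)" for x y
      by (intro chi_cong cong_mult cong_diff cong_refl that)
  qed (rule P_prime)
  also have "\<dots> = (\<Sum>w\<in>{0..<P}. chi (((1 - s) + s * w) * (w * w)))"
    by (simp add: algebra_simps)
  also have "\<dots> = (\<Sum>w\<in>{1..<P}. chi (((1 - s) + s * w) * (w * w)))"
    by (subst sum_remove_0) (simp add: chi_0)
  also have "\<dots> = - chi s + (if s = 1 then of_int P else 0)"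
  proof (cases "s = 1")
    case True
    have "(\<Sum>w\<in>{1..<P}. chi (((1 - s) + s * w) * (w * w))) = (\<Sum>w\<in>{1..<P}. 1)"
      using True by (intro sum.cong) (auto simp: chi_mult mult.assoc[symmetric] chi_cube ndvd)
    also have "\<dots> = of_int P - 1" using P_gt_1 by (simp add: of_nat_diff)
    finally show ?thesis using True chi_1 by simp
  next
    case False
    have "\<not> P dvd 1 - s"
    proof
      assume "P dvd 1 - s"
      then have "\<bar>P\<bar> \<le> \<bar>1 - s\<bar>" using False by (intro dvd_imp_le_int) auto
      then show False using s P_gt_1 by auto
    qed
    from sum_chi_cubic[OF this, of s] False show ?thesis by simp
  qed
  \<comment> \<open>The extra -1 removes the term y = 0, which is \<open>chi 1\<close>.\<close>
  finally show ?thesis using sum_remove_0[of ?G] by (simp add: chi_1 algebra_simps)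
qed

text \<open>Expand into a double sum and put x = y s. The factor y^3 has character 1, and after
  exchanging the sums only the P at s = 1 survives, because \<open>chi\<close> and its square sum to
  zero.\<close>

lemma jacobi_norm: "jacobi * cnj jacobi = of_int P"
proof -
  let ?G = "\<lambda>s y. chi ((1 - s * y) * ((1 - y) * (1 - y)))"
  let ?Y = "\<lambda>y. (y * (1 - y)) * (y * (1 - y))"
  have "cnj jacobi = (\<Sum>y\<in>{0..<P}. chi (?Y y))" by (simp add: jacobi_def cnj_chi)
  also have "\<dots> = (\<Sum>y\<in>{1..<P}. chi (?Y y))" by (subst sum_remove_0) (simp add: chi_0)
  finally have "jacobi * cnj jacobi = (\<Sum>y\<in>{1..<P}. jacobi * chi (?Y y))"
    by (simp add: sum_distrib_left)
  also have "\<dots> = (\<Sum>y\<in>{1..<P}. \<Sum>s\<in>{0..<P}. chi s * ?G s y)"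
  proof (rule sum.cong[OF refl])
    fix y assume y: "y \<in> {1..<P}"
    have "jacobi * chi (?Y y) = (\<Sum>x\<in>{0..<P}. chi (x * (1 - x) * ?Y y))"
      by (simp add: jacobi_def sum_distrib_right chi_mult)
    also have "\<dots> = (\<Sum>s\<in>{0..<P}. chi ((y * s + 0) * (1 - (y * s + 0)) * ?Y y))"
      by (rule sum_affine_mod[symmetric, OF P_prime ndvd[OF y]])
        (intro chi_cong cong_mult cong_diff cong_refl)
    also have "\<dots> = (\<Sum>s\<in>{0..<P}. chi s * ?G s y)"
    proof (rule sum.cong[OF refl])
      fix s
      have "(y * s + 0) * (1 - (y * s + 0)) * ?Y y
          = y * y * y * (s * ((1 - s * y) * ((1 - y) * (1 - y))))"
        by (simp add: algebra_simps)
      then show "chi ((y * s + 0) * (1 - (y * s + 0)) * ?Y y) = chi s * ?G s y"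
        using chi_cube[OF ndvd[OF y]] by (simp only: chi_mult) simp
    qed
    finally show "jacobi * chi (?Y y) = (\<Sum>s\<in>{0..<P}. chi s * ?G s y)" .
  qed
  also have "\<dots> = (\<Sum>s\<in>{0..<P}. chi s * (\<Sum>y\<in>{1..<P}. ?G s y))"
    by (subst sum.swap) (simp add: sum_distrib_left)
  also have "\<dots> = (\<Sum>s\<in>{0..<P}. - (chi s * chi s) - chi s + (if s = 1 then of_int P else 0))"
  proof (rule sum.cong[OF refl])
    fix s assume "s \<in> {0..<P}"
    from jacobi_inner_sum[OF this] show "chi s * (\<Sum>y\<in>{1..<P}. ?G s y)
        = - (chi s * chi s) - chi s + (if s = 1 then of_int P else 0)"
      by (simp only: chi_1 split: if_split) (auto simp: chi_1 algebra_simps)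
  qed
  also have "\<dots> = of_int P"
    using P_gt_1 by (simp add: sum.distrib sum_subtractf sum_negf sum_chi sum_chi_sq)
  finally show ?thesis .
qed

lemma enorm_jacobi: "enorm jre jim = P"
  using jacobi_norm unfolding jacobi_eis eis_norm by (metis of_int_eq_iff)

text \<open>Every term of the sum of \<open>(1 + \<chi> + \<chi>')(x) (1 + \<chi> + \<chi>')(1 - x)\<close>, where \<open>\<chi>'\<close> is the conjugate
  character, is divisible by 9 apart from \<open>x = 0, 1\<close>.\<close>

lemma jacobi_trace: "\<exists>M. P - 8 + (2 * jre - jim) = 9 * M"
proof -
  \<comment> \<open>For x prime to p this is three times the indicator function of the
    cubes.\<close>
  define c where "c x = 1 + chi x + cnj (chi x)" for x
  have c3: "\<exists>m. c x = 3 * of_int m" if nd: "\<not> P dvd x" for x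
  proof -
    obtain e where e: "e < 3" "[x ^ k = theta ^ e] (mod P)" using power_k_cases[OF nd] by metis
    from e(1) consider "e = 0" | "e = 1" | "e = 2" by linarith
    then show ?thesis
    proof cases
      case 1 then show ?thesis using chi_eqI[OF nd e(2)] by (auto simp: c_def intro: exI[of _ 1])
    next
      case 2 then show ?thesis using chi_eqI[OF nd e(2)]
        by (auto simp: c_def cnj_omega intro: exI[of _ 0])
    next
      case 3
      then have "chi x = -1 - omega"
        using chi_eqI[OF nd e(2)] by (simp add: power2_eq_square omega_sq)
      then show ?thesis by (auto simp: c_def cnj_omega intro: exI[of _ 0])
    qed
  qed
  have c0: "c 0 = 1" "c 1 = 3" by (simp_all add: c_def chi_0 chi_1)
  have "\<forall>x\<in>{2..<P}. \<exists>m. c x * c (1 - x) = 9 * of_int m"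
  proof
    fix x assume "x \<in> {2..<P}"
    then have "\<not> P dvd x" "\<not> P dvd 1 - x"
      using ndvd[of x] ndvd[of "x - 1"] by (auto simp: dvd_diff_commute)
    then obtain m n where "c x = 3 * of_int m" "c (1 - x) = 3 * of_int n" using c3 by meson
    then show "\<exists>m. c x * c (1 - x) = 9 * of_int m" by (intro exI[of _ "m*n"]) simp
  qed
  then obtain m where m: "\<forall>x\<in>{2..<P}. c x * c (1 - x) = 9 * of_int (m x)" by metis
  \<comment> \<open>The terms x = 0 and x = 1 each contribute 1 * 3, whence the 6.\<close>
  have "{0..<P} = insert 0 (insert 1 {2..<P})" using P_gt_1 by auto
  then have "(\<Sum>x\<in>{0..<P}. c x * c (1 - x)) = 6 + (\<Sum>x\<in>{2..<P}. c x * c (1 - x))"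
    by (simp add: c0)
  also have "\<dots> = of_int (6 + 9 * (\<Sum>x\<in>{2..<P}. m x))" using m by (simp add: sum_distrib_left)
  finally have 1: "(\<Sum>x\<in>{0..<P}. c x * c (1 - x)) = of_int (6 + 9 * (\<Sum>x\<in>{2..<P}. m x))" .
  have A: "(\<Sum>x\<in>{0..<P}. chi (1 - x)) = 0"
    using sum_chi_affine[of "-1" 1] P_gt_1 by simp
  have B: "(\<Sum>x\<in>{0..<P}. chi (1 - x) * chi x * chi x) = -1"
    using sum_chi_cubic[of 1 "-1"] P_gt_1 chi_minus_1
    by (subst sum_remove_0) (simp add: chi_0 chi_mult mult.assoc)
  have C: "(\<Sum>x\<in>{0..<P}. chi x * chi (1 - x) * chi (1 - x)) = -1"
  proof -
    have "(\<Sum>x\<in>{0..<P}. chi x * chi (1 - x) * chi (1 - x)) =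
       (\<Sum>x\<in>{0..<P}. chi (-1*x+1) * chi (1 - (-1*x+1)) * chi (1 - (-1*x+1)))"
      by (rule sum_affine_mod[symmetric, OF P_prime])
        (use P_gt_1 in \<open>auto intro!: arg_cong2[of _ _ _ _ "(*)"] chi_cong cong_diff\<close>)
    also have "\<dots> = (\<Sum>x\<in>{0..<P}. chi (1 - x) * chi x * chi x)" by simp
    finally show ?thesis using B by simp
  qed
  \<comment> \<open>Summed over x, the nine products give p, four zeros, the Jacobi sum, its
    conjugate, and twice -1.\<close>
  have "c x * c (1 - x) = 1 + chi x + cnj (chi x) + chi (1 - x) + cnj (chi (1 - x))
      + chi (x * (1 - x)) + cnj (chi (x * (1 - x)))
      + chi x * chi (1 - x) * chi (1 - x) + chi (1 - x) * chi x * chi x" for x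
    unfolding c_def chi_mult complex_cnj_mult cnj_chi by (simp add: ring_distribs ac_simps)
  then have "(\<Sum>x\<in>{0..<P}. c x * c (1 - x)) =
      of_int P + 0 + cnj 0 + 0 + cnj 0 + jacobi + cnj jacobi + -1 + -1"
    by (simp only: sum.distrib jacobi_def A sum_chi B C cnj_sum[symmetric]) simp
  then have "(\<Sum>x\<in>{0..<P}. c x * c (1 - x)) = of_int (P + (2 * jre - jim) - 2)"
    by (simp add: jacobi_eis eis_def cnj_omega algebra_simps)
  with 1 have "6 + 9 * (\<Sum>x\<in>{2..<P}. m x) = P + (2 * jre - jim) - 2" by (metis of_int_eq_iff)
  then show ?thesis by (intro exI[of _ "\<Sum>x\<in>{2..<P}. m x"]) simp
qed

text \<open>Four times the norm is the squared trace plus \<open>3 * jim^2\<close>; the trace modulo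
  9 makes 9 divide \<open>3 * jim^2\<close>. Thus the Jacobi sum is a rational integer modulo
  3.\<close>

lemma jim_dvd: "3 dvd jim"
proof -
  obtain M where M: "P - 8 + (2 * jre - jim) = 9 * M" using jacobi_trace by blast
  then have "2 * jre - jim = 9 * M + 7 - 3 * int k" using p_eq by simp
  moreover have "4 * P = (2 * jre - jim)^2 + 3 * jim^2" using four_enorm[of jre jim] enorm_jacobi by simp
  ultimately have "3 * jim^2 = 4 * (3 * int k + 1) - (9 * M + 7 - 3 * int k)^2" using p_eq by simp
  also have "\<dots> = 9 * (6 * int k - 5 - (3*M - int k)^2 - 14 * M)"
    by (simp add: algebra_simps power2_eq_square)
  finally have "3 dvd jim^2" by presburger
  then show ?thesis using prime_dvd_power[of "3::int" jim 2] by simp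
qed

section \<open>Reduction of the Jacobi sum modulo the two primes above p\<close>

definition "psum r = (\<Sum>x\<in>{0..<P}. x ^ r)"

text \<open>Substituting g x for x multiplies the power sum by \<open>g ^ r\<close>, which is not 1
  modulo p.\<close>

lemma psum_dvd: "\<not> 3 * k dvd r \<Longrightarrow> P dvd psum r"
proof -
  assume r: "\<not> 3 * k dvd r"
  let ?f = "\<lambda>x. x ^ r mod P"
  have "(\<Sum>x\<in>{0..<P}. ?f (g * x + 0)) = (\<Sum>x\<in>{0..<P}. ?f x)"
    by (rule sum_affine_mod[OF P_prime g_ndvd]) (metis cong_def cong_pow)
  then have "[(\<Sum>x\<in>{0..<P}. (g * x) ^ r) = (\<Sum>x\<in>{0..<P}. x ^ r)] (mod P)"
    by (simp add: cong_def) (metis mod_sum_eq)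
  then have "P dvd (g ^ r - 1) * psum r"
    by (simp add: psum_def cong_iff_dvd_diff power_mult_distrib sum_distrib_left left_diff_distrib sum_subtractf)
  moreover have "\<not> P dvd g ^ r - 1" using g_order r by (simp add: cong_iff_dvd_diff)
  ultimately show ?thesis using P_prime by (simp add: prime_dvd_mult_iff)
qed

lemma psum_cong: "[psum (3 * k) = -1] (mod P)"
proof -
  have "{0..<P} = insert 0 {1..<P}" using P_gt_1 by auto
  then have "psum (3 * k) = (\<Sum>x\<in>{1..<P}. x ^ (3 * k))" using k_pos by (simp add: psum_def)
  also have "[\<dots> = (\<Sum>x\<in>{1..<P}. 1)] (mod P)" by (intro cong_sum fermat ndvd)
  also have "(\<Sum>x\<in>{1..<P}. 1) = P - 1" using P_gt_1 by simp
  also have "[P - 1 = -1] (mod P)" by (simp add: cong_iff_dvd_diff)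
  finally show ?thesis .
qed

lemma sum_jacobi_power:
  "(\<Sum>x\<in>{0..<P}. (x * (1 - x)) ^ m) = (\<Sum>j\<le>m. (-1) ^ j * int (m choose j) * psum (m + j))"
proof -
  have "(x * (1 - x)) ^ m = (\<Sum>j\<le>m. (-1) ^ j * int (m choose j) * x ^ (m + j))" for x :: int
  proof -
    have "(x * (1 - x)) ^ m = x ^ m * (- x + 1) ^ m" by (simp add: power_mult_distrib)
    also have "(- x + 1) ^ m = (\<Sum>j\<le>m. int (m choose j) * (- x) ^ j)"
      by (subst binomial_ring) simp
    also have "x ^ m * \<dots> = (\<Sum>j\<le>m. (-1) ^ j * int (m choose j) * x ^ (m + j))"
      by (simp add: sum_distrib_left power_add power_minus[of x] mult_ac)
    finally show ?thesis .
  qed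
  then show ?thesis unfolding psum_def by (simp add: sum_distrib_left) (rule sum.swap)
qed

text \<open>The exponents k + j with j \<le> k lie strictly between 0 and 3k, so all power sums
  vanish: the prime with \<omega> \<mapsto> theta divides the Jacobi sum.\<close>

lemma jacobi_theta: "[jre + jim * theta = 0] (mod P)"
proof -
  have "jre + jim * theta = (\<Sum>x\<in>{0..<P}. re (x * (1 - x)) + im (x * (1 - x)) * theta)"
    by (simp add: jre_def jim_def sum.distrib sum_distrib_right)
  also have "[\<dots> = (\<Sum>x\<in>{0..<P}. (x * (1 - x)) ^ k)] (mod P)"
    by (intro cong_sum cong_sym[OF chi_reduce(1)])
  also have "[(\<Sum>x\<in>{0..<P}. (x * (1 - x)) ^ k) = 0] (mod P)"
    unfolding sum_jacobi_power cong_0_iff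
  proof (intro dvd_sum dvd_mult psum_dvd)
    fix j assume "j \<in> {..k}"
    then have "0 < k + j" "k + j < 3 * k" using k_pos by auto
    then show "\<not> 3 * k dvd k + j" by (auto dest: dvd_imp_le)
  qed
  finally show ?thesis .
qed

text \<open>By Wilson, \<open>-1 \<equiv> (3k)! \<equiv> (2k)! (-1)\<^sup>k k!\<close> since \<open>2k + j \<equiv> -(k + 1 - j)\<close>. This is what makes the
  conjugate Jacobi sum a cube and replaces an appeal to cubic reciprocity.\<close>

lemma binomial_cube: "[int ((2 * k) choose k) * fact k ^ 3 = -1] (mod P)"
proof -
  have "[(\<Prod>j\<in>{1..k}. int (2 * k + j)) = (\<Prod>j\<in>{1..k}. - int (k + 1 - j))] (mod P)"
  proof (rule cong_prod)
    fix j assume "j \<in> {1..k}"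
    then have "int (2 * k + j) - (- int (k + 1 - j)) = P" using p_eq by simp
    then show "[int (2 * k + j) = - int (k + 1 - j)] (mod P)" by (simp add: cong_iff_dvd_diff)
  qed
  also have "(\<Prod>j\<in>{1..k}. - int (k + 1 - j)) = (\<Prod>j\<in>{1..k}. int (k + 1 - j))"
  proof -
    have "(\<Prod>j\<in>{1..i}. - f j) = (-1) ^ i * (\<Prod>j\<in>{1..i}. f j)" for i and f :: "nat \<Rightarrow> int"
      by (induction i) auto
    from this[of "\<lambda>j. int (k + 1 - j)" k] show ?thesis using k_even by simp
  qed
  also have "(\<Prod>j\<in>{1..k}. int (k + 1 - j)) = (\<Prod>j\<in>{1..k}. int j)"
    by (rule prod.reindex_bij_witness[of _ "\<lambda>j. k + 1 - j" "\<lambda>j. k + 1 - j"]) auto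
  also have "\<dots> = fact k" by (simp add: fact_prod)
  finally have 1: "[(\<Prod>j\<in>{1..k}. int (2 * k + j)) = fact k] (mod P)" .
  have 2: "fact (2 * k) * (\<Prod>j\<in>{1..i}. int (2 * k + j)) = fact (2 * k + i)" for i
    by (induction i) (simp_all add: mult.assoc[symmetric] mult.commute)
  have "(fact (2 * k) :: nat) = fact k * fact k * (2 * k choose k)"
    using binomial_fact_lemma[of k "2 * k"] by (simp add: mult_2)
  then have 3: "(fact (2 * k) :: int) = fact k * fact k * int (2 * k choose k)"
    by (metis of_nat_fact of_nat_mult)
  have "int (2 * k choose k) * fact k ^ 3 = fact (2 * k) * fact k"
    unfolding 3 by (simp add: power3_eq_cube)
  also have "[\<dots> = fact (2 * k) * (\<Prod>j\<in>{1..k}. int (2 * k + j))] (mod P)"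
    by (intro cong_mult cong_refl cong_sym[OF 1])
  also have "fact (2 * k) * (\<Prod>j\<in>{1..k}. int (2 * k + j)) = fact (p - 1)"
    unfolding 2 by (simp add: p_eq)
  also have "[fact (p - 1) = -1] (mod P)" by (rule wilson_theorem[OF prime_p])
  finally show ?thesis .
qed

text \<open>Under \<omega> \<mapsto> theta^2 the exponents run from 2k to 4k and meet a multiple of
  3k only at j = k. What is left is minus a central binomial coefficient, which
  \<open>binomial_cube\<close> evaluates.\<close>

lemma jacobi_theta_sq: "[(jre + jim * theta^2) * fact k ^ 3 = 1] (mod P)"
proof -
  have "jre + jim * theta^2 = (\<Sum>x\<in>{0..<P}. re (x * (1 - x)) + im (x * (1 - x)) * theta^2)"
    by (simp add: jre_def jim_def sum.distrib sum_distrib_right)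
  also have "[\<dots> = (\<Sum>x\<in>{0..<P}. (x * (1 - x)) ^ (2*k))] (mod P)"
    by (intro cong_sum cong_sym[OF chi_reduce(2)])
  also have "[(\<Sum>x\<in>{0..<P}. (x * (1 - x)) ^ (2*k)) =
      (\<Sum>j\<le>2*k. if j = k then - int (2 * k choose k) else 0)] (mod P)"
    unfolding sum_jacobi_power
  proof (intro cong_sum)
    fix j assume j: "j \<in> {..2*k}"
    show "[(-1) ^ j * int (2 * k choose j) * psum (2 * k + j) =
       (if j = k then - int (2 * k choose k) else 0)] (mod P)"
    proof (cases "j = k")
      case True
      have "2 * k + k = 3 * k" by simp
      then show ?thesis using True k_even cong_scalar_left[OF psum_cong, of "int (2 * k choose k)"] by simp
    next
      case False
      have "\<not> 3 * k dvd 2 * k + j"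
      proof
        assume "3 * k dvd 2 * k + j"
        then obtain c where c: "2 * k + j = 3 * k * c" by blast
        have "c \<noteq> 0" using c k_pos by (cases c) auto
        moreover have "c \<noteq> 1" using c False by auto
        moreover have "c < 2"
        proof (rule ccontr)
          assume "\<not> c < 2"
          then have "3 * k * 2 \<le> 3 * k * c" by (intro mult_le_mono2) simp
          then show False using c j k_pos unfolding atMost_iff by linarith
        qed
        ultimately show False by simp
      qed
      then show ?thesis using False psum_dvd by (simp add: cong_0_iff)
    qed
  qed
  also have "(\<Sum>j\<le>2*k. if j = k then - int (2 * k choose k) else 0) = - int (2 * k choose k)"
    by simp
  finally have "[(jre + jim * theta^2) * fact k ^ 3 = - int (2 * k choose k) * fact k ^ 3] (mod P)"
    by (rule cong_scalar_right)
  also have "[- int (2 * k choose k) * fact k ^ 3 = 1] (mod P)"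
    using binomial_cube by (simp add: cong_iff_dvd_diff) (metis dvd_minus_iff minus_add_distrib uminus_add_conv_diff add.commute)
  finally show ?thesis .
qed

end

text \<open>Here \<open>eis a b\<close> is the Jacobi sum, t is \<open>theta\<close>, and f is the
  factorial of (p - 1)/3. As -1 - t is t^2 modulo p, evaluating the conjugate at t is evaluating the
  sum itself at t^2.\<close>

lemma jacobi_sum_ex:
  fixes p :: nat
  assumes p: "prime p" "p mod 3 = 1"
  shows "\<exists>a b t f. enorm a b = int p \<and> 3 dvd b \<and> [a + b * t = 0] (mod int p) \<and>
    int p dvd t^2 + t + 1 \<and> [(a - b - b * t) * f ^ 3 = 1] (mod int p)"
proof -
  obtain g where g: "residue_primroot p g" using prime_primitive_root_exists[OF prime_gt_1_nat[OF p(1)] p(1)] by blast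
  then have "ord p g = p - 1" using p(1) by (simp add: residue_primroot_def totient_prime)
  moreover have pk: "p = 3 * (p div 3) + 1" using p(2) by presburger
  ultimately have ord: "ord p g = 3 * (p div 3)" by simp
  interpret cubic_residues p "p div 3" "int g"
  proof
    show "[int g ^ d = 1] (mod int p) \<longleftrightarrow> 3 * (p div 3) dvd d" for d
      using ord_divides[of g d p] ord by (metis cong_int_iff of_nat_1 of_nat_power)
  qed (use p pk in auto)
  have "int p dvd jim * (theta^2 + theta + 1)" using theta_sum by simp
  then have "[jre - jim - jim * theta = jre + jim * theta^2] (mod int p)"
    by (simp add: cong_iff_dvd_diff algebra_simps dvd_diff_commute)
      (metis add.commute add.left_commute dvd_minus_iff minus_add_distrib uminus_add_conv_diff)
  then have "[(jre - jim - jim * theta) * fact (p div 3) ^ 3 = 1] (mod int p)"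
    using cong_trans[OF cong_scalar_right jacobi_theta_sq] by blast
  then show ?thesis using enorm_jacobi jim_dvd jacobi_theta theta_sum by blast
qed

lemma fermat_int_power:
  fixes q :: nat and x :: int
  assumes q: "prime q"
  shows "[x ^ q = x] (mod int q)"
proof (cases "int q dvd x")
  case True
  then have "int q dvd x ^ q" using prime_gt_0_nat[OF q] dvd_trans[OF True dvd_power[of q x]] by simp
  then show ?thesis using True by (simp add: cong_iff_dvd_diff)
next
  case False
  have "x ^ q = x ^ (q - 1) * x" using prime_gt_0_nat[OF q] by (simp add: power_eq_if mult.commute)
  then show ?thesis using cong_scalar_right[OF fermat_int[OF q False], of x] by simp
qed

section \<open>Cubes of Eisenstein integers\<close>

lemma enorm_factor: "(x + y) * enorm x y = x^3 + y^3"
  by (simp add: enorm_def algebra_simps power2_eq_square power3_eq_cube)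

text \<open>For q \<equiv> 2 modulo 3 cubing is injective modulo q, so q dividing x^3 + y^3 divides
  x + y; then it divides 3xy, against coprimality.\<close>

lemma prime_dvd_enorm_mod3:
  fixes q :: nat
  assumes q: "prime q" and cop: "coprime x y" and dvd: "int q dvd enorm x y" and "q \<noteq> 3"
  shows "q mod 3 = 1"
proof (rule ccontr)
  assume "q mod 3 \<noteq> 1"
  moreover have "q mod 3 \<noteq> 0"
    using primes_dvd_imp_eq[of 3 q] q \<open>q \<noteq> 3\<close> by (auto simp: dvd_eq_mod_eq_0)
  ultimately have "q mod 3 = 2" by presburger
  then obtain m where m: "q = 3 * m + 2" by (metis div_mult_mod_eq mult.commute)
  \<comment> \<open>Raising to the power 2m + 1 inverts cubing, as 3(2m + 1) = 2(q - 1) + 1.\<close>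
  have cube_root: "[z = (z^3) ^ (2*m+1)] (mod int q)" for z :: int
  proof (cases "int q dvd z")
    case True
    then have "int q dvd (z^3)^(2*m+1)" by (simp add: power3_eq_cube)
    then show ?thesis using True by (simp add: cong_iff_dvd_diff)
  next
    case False
    have "3 * (2*m+1) = (q - 1) * 2 + 1" using m by simp
    then have "(z^3) ^ (2*m+1) = (z ^ (q-1)) ^ 2 * z"
      by (metis power_add power_mult power_one_right)
    moreover have "[(z ^ (q-1)) ^ 2 * z = 1 ^ 2 * z] (mod int q)"
      by (intro cong_mult cong_pow cong_refl fermat_int q False)
    ultimately show ?thesis by (simp add: cong_sym)
  qed
  have "int q dvd x^3 + y^3" using dvd enorm_factor[of x y] by (metis dvd_mult)
  then have "[x^3 = (-y)^3] (mod int q)" by (simp add: cong_iff_dvd_diff)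
  then have "[(x^3)^(2*m+1) = ((-y)^3)^(2*m+1)] (mod int q)" by (rule cong_pow)
  then have "[x = -y] (mod int q)" using cube_root[of x] cube_root[of "-y"]
    by (meson cong_sym cong_trans)
  then have xy: "int q dvd x + y" by (simp add: cong_iff_dvd_diff)
  have "3 * (x * y) = (x + y) * (x + y) - enorm x y"
    by (simp add: enorm_def algebra_simps power2_eq_square)
  then have "int q dvd 3 * (x * y)" using xy dvd by simp
  moreover have "\<not> int q dvd 3"
  proof
    assume "int q dvd 3"
    then have "int q dvd int 3" by simp
    then have "q dvd 3" by (simp only: int_dvd_int_iff)
    then show False using primes_dvd_imp_eq[of q 3] q \<open>q \<noteq> 3\<close> by simp
  qed
  ultimately have "int q dvd x \<or> int q dvd y" using q by (simp add: prime_dvd_mult_iff)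
  then have "int q dvd x \<and> int q dvd y" using xy by (metis dvd_add_left_iff dvd_add_right_iff)
  then have "is_unit (int q)" using cop coprime_common_divisor by blast
  then show False using q by simp
qed

lemma eis_omega_power_ex: "\<exists>u v. omega ^ s = eis u v"
  unfolding eis_omega by (rule eis_power_ex)

text \<open>Induction on the cube root b of the norm: a prime q dividing b is split, the cube of one
  prime above q is extracted, and in the end a unit remains.\<close>

lemma eis_cube_of_norm_cube:
  fixes b :: nat
  assumes "coprime x y" "enorm x y = int b ^ 3" "\<not> 3 dvd b"
  shows "\<exists>s u v. s < 3 \<and> eis x y = omega ^ s * eis u v ^ 3"
  using assms
proof (induction b arbitrary: x y rule: less_induct)
  case (less b)
  show ?case
  proof (cases "b = 1")
    case True
    then show ?thesis using eis_unit less.prems by fastforce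
  next
    case False
    have "b \<noteq> 0" using less.prems(3) by (metis dvd_0_right)
    from False obtain q where q: "prime q" "q dvd b" using prime_factor_nat by blast
    have "q \<noteq> 3" using q less.prems(3) by blast
    from q obtain c where c: "b = q * c" by blast
    have N: "int q ^ 3 dvd enorm x y" unfolding less.prems c by (simp add: power_mult_distrib)
    then have "int q dvd enorm x y" by (metis dvd_mult_left power3_eq_cube mult.assoc)
    then have "q mod 3 = 1" using prime_dvd_enorm_mod3 q(1) less.prems(1) \<open>q \<noteq> 3\<close> by blast
    then obtain d e where "enorm d e = int q" using jacobi_sum_ex[OF q(1)] by blast
    then obtain d e u v where "enorm d e = int q" and eq: "eis x y = eis d e ^ 3 * eis u v"
      using eis_prime_power_dvd[of "int q" d e x y 3] q(1) less.prems(1) N enorm_conj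
      by (metis prime_nat_int_transfer)
    then obtain d' e' where de: "eis d e ^ 3 = eis d' e'" "enorm d' e' = int q ^ 3"
      using eis_power_ex enorm_power by metis
    then have "int q ^ 3 * int c ^ 3 = int q ^ 3 * enorm u v"
      using enorm_mult[of x y d' e' u v] eq less.prems(2) c by (simp add: power_mult_distrib)
    then have "enorm u v = int c ^ 3" using q(1) by (auto simp: prime_gt_0_nat)
    moreover have "coprime u v" using coprime_eis_factor eq de less.prems(1) by metis
    moreover have "\<not> 3 dvd c" using c less.prems(3) by (metis dvd_mult)
    moreover have "c < b" using c \<open>b \<noteq> 0\<close> prime_gt_1_nat[OF q(1)] by simp
    ultimately obtain s f g where s: "s < 3" "eis u v = omega ^ s * eis f g ^ 3"
      using less.IH by blast
    have "eis x y = omega ^ s * (eis d e * eis f g) ^ 3"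
      unfolding eq s by (simp add: power_mult_distrib)
    then show ?thesis using s(1) unfolding eis_mult by blast
  qed
qed

lemma eis_cube: "eis u v ^ 3 = eis (u^3 + v^3 - 3*u*v^2) (3*u*v*(u-v))"
proof -
  have "eis u v ^ 3 = eis u v * (eis u v * eis u v)" by (simp add: power3_eq_cube)
  then show ?thesis by (simp add: eis_mult algebra_simps power2_eq_square power3_eq_cube)
qed

lemma three_dvd_prod_iff: "(3::int) dvd a * b \<longleftrightarrow> 3 dvd a \<or> 3 dvd b"
  by (rule prime_dvd_mult_iff) simp

lemma three_dvd_power_iff: "n > 0 \<Longrightarrow> (3::int) dvd a ^ n \<longleftrightarrow> 3 dvd a"
  by (rule prime_dvd_power_iff) auto

lemma three_dvd_enorm_iff: "3 dvd enorm x y \<longleftrightarrow> 3 dvd x + y"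
proof -
  have "enorm x y = (x + y)^2 - 3 * (x * y)"
    by (simp add: enorm_def algebra_simps power2_eq_square)
  then have "3 dvd enorm x y \<longleftrightarrow> 3 dvd (x+y)^2"
    by (simp add: dvd_diff_left_iff)
  then show ?thesis by (simp add: three_dvd_power_iff)
qed

text \<open>Modulo 3 such a cube is a rational integer prime to 3, so congruences on the coordinates
  can detect an additional power of \<omega>.\<close>

lemma eis_cube_real_mod3:
  assumes "\<not> 3 dvd enorm u v" "eis u v ^ 3 = eis r s"
  shows "3 dvd s" "\<not> 3 dvd r"
proof -
  have rs: "r = u^3 + v^3 - 3*u*v^2" "s = 3*u*v*(u-v)" using assms(2) unfolding eis_cube by auto
  then show "3 dvd s" by simp
  have "r = (u+v) * enorm u v - 3 * (u*v^2)" unfolding enorm_factor rs by simp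
  then show "\<not> 3 dvd r" using assms(1) by (simp add: dvd_diff_left_iff three_dvd_prod_iff three_dvd_enorm_iff)
qed

lemma eis_power_real_mod3:
  assumes "3 dvd d" "eis c d ^ k = eis r s"
  shows "3 dvd s"
  using assms(2)
proof (induction k arbitrary: r s)
  case 0
  then have "eis 1 0 = eis r s" by (metis eis_int of_int_1 power_0)
  then show ?case by simp
next
  case (Suc k)
  obtain r' s' where *: "eis c d ^ k = eis r' s'" using eis_power_ex by blast
  then have "eis r s = eis c d * eis r' s'" using Suc.prems by simp
  then show ?case using Suc.IH[OF *] assms(1) by (auto simp: eis_mult)
qed

section \<open>Detecting the power of omega, and evaluation of omega modulo p\<close>

lemma eis_omega_mult:
  "eis x y = omega ^ 0 * eis r s \<Longrightarrow> x = r \<and> y = s"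
  "eis x y = omega ^ 1 * eis r s \<Longrightarrow> x = - s \<and> y = r - s"
  "eis x y = omega ^ 2 * eis r s \<Longrightarrow> x = s - r \<and> y = - r"
  by (auto simp: eis_omega power2_eq_square eis_mult)

text \<open>For s = 0, 1, 2 the coordinates (x, y) are (r, 0), (0, r), (-r, -r) modulo 3.\<close>

lemma omega_exponent_mod3:
  assumes "s < 3" "eis x y = omega ^ s * eis r t" "3 dvd t" "\<not> 3 dvd r"
  shows "s = 0 \<longleftrightarrow> 3 dvd y" "s = 2 \<longleftrightarrow> 3 dvd x - y"
proof -
  consider "s = 0" | "s = 1" | "s = 2" using assms(1) by linarith
  then have "(s = 0 \<longleftrightarrow> 3 dvd y) \<and> (s = 2 \<longleftrightarrow> 3 dvd x - y)"
  proof cases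
    case 1
    then show ?thesis using eis_omega_mult(1)[of x y r t] assms by (auto simp: dvd_diff_left_iff)
  next
    case 2
    then show ?thesis using eis_omega_mult(2)[of x y r t] assms
      by (simp add: dvd_diff_left_iff)
  next
    case 3
    then show ?thesis using eis_omega_mult(3)[of x y r t] assms by auto
  qed
  then show "s = 0 \<longleftrightarrow> 3 dvd y" "s = 2 \<longleftrightarrow> 3 dvd x - y" by auto
qed

text \<open>Evaluation at a root t of T^2 + T + 1 modulo P is a ring homomorphism on
  Z[\<omega>].\<close>

lemma eval_mult:
  assumes "eis x y = eis a b * eis c d" "P dvd t^2 + t + 1"
  shows "[x + y * t = (a + b * t) * (c + d * t)] (mod P)"
proof -
  have xy: "x = a*c - b*d" "y = a*d + b*c - b*d" using assms(1) by (simp_all add: eis_mult)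
  have "x + y*t - (a + b*t) * (c + d*t) = - (b * d) * (t^2 + t + 1)"
    unfolding xy by (simp add: algebra_simps power2_eq_square)
  then show ?thesis using assms(2) by (simp add: cong_iff_dvd_diff)
qed

lemma eval_power:
  assumes "eis x y = eis a b ^ k" "P dvd t^2 + t + 1"
  shows "[x + y * t = (a + b * t) ^ k] (mod P)"
  using assms(1)
proof (induction k arbitrary: x y)
  case 0
  then have "eis x y = eis 1 0" by (metis eis_int of_int_1 power_0)
  then show ?case by simp
next
  case (Suc k)
  obtain r' s' where *: "eis r' s' = eis a b ^ k" using eis_power_ex by metis
  then have "eis x y = eis a b * eis r' s'" using Suc.prems by simp
  from eval_mult[OF this assms(2)] cong_scalar_left[OF Suc.IH[OF *], of "a + b*t"]
  show ?case using cong_trans by fastforce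
qed

text \<open>Here \<open>t\<close> is the image of \<open>\<omega>\<close> in \<open>\<int>[\<omega>]/\<pi>\<close> for a suitable prime \<open>\<pi>\<close> above \<open>p\<close>, and the two
  congruences say that \<open>\<pi>\<close> divides \<open>r + s\<omega>\<close> while the conjugate \<open>r - s - s\<omega>\<close> is a cube modulo \<open>\<pi>\<close>.\<close>

lemma eis_prime_power_times_cube:
  fixes p b :: nat
  assumes p: "prime p" "p mod 3 = 1" and k: "k > 0" and cop: "coprime x y"
    and N: "enorm x y = int p ^ k * int b ^ 3" and b: "\<not> 3 dvd b"
  shows "\<exists>e r s t F h. e < 3 \<and> eis x y = omega ^ e * eis r s \<and> 3 dvd s \<and> \<not> 3 dvd r \<and>
    int p dvd t^2 + t + 1 \<and> [r + s * t = 0] (mod int p) \<and>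
    [(r - s - s * t) * F ^ 3 = h ^ 3] (mod int p) \<and> \<not> int p dvd F"
proof -
  obtain a0 b0 t0 f where J: "enorm a0 b0 = int p" "3 dvd b0" "[a0 + b0 * t0 = 0] (mod int p)"
    "int p dvd t0^2 + t0 + 1" "[(a0 - b0 - b0 * t0) * f ^ 3 = 1] (mod int p)"
    using jacobi_sum_ex[OF p] by metis
  have "int p ^ k dvd enorm x y" using N by simp
  then obtain c d u v where cd: "c = a0 \<and> d = b0 \<or> c = a0 - b0 \<and> d = - b0"
    and eq: "eis x y = eis c d ^ k * eis u v"
    using eis_prime_power_dvd[of "int p" a0 b0 x y k] p(1) J(1) cop by auto
  obtain t where t: "[c + d * t = 0] (mod int p)" "int p dvd t^2 + t + 1"
    "[(c - d - d * t) * f ^ 3 = 1] (mod int p)" and cd3: "3 dvd d" "enorm c d = int p"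
  proof (cases "c = a0 \<and> d = b0")
    case True
    then show ?thesis using that J by blast
  next
    case False
    then have *: "c = a0 - b0" "d = - b0" using cd by auto
    \<comment> \<open>If the conjugate of the Jacobi sum is the prime that divides, pass to the
      other root -1 - t0; the two changes cancel.\<close>
    have 1: "c + d * (-1 - t0) = a0 + b0 * t0" "(-1 - t0)^2 + (-1 - t0) + 1 = t0^2 + t0 + 1"
      "c - d - d * (-1 - t0) = a0 - b0 - b0 * t0"
      by (simp_all add: * algebra_simps power2_eq_square)
    show ?thesis
    proof (rule that[of "-1 - t0"])
      show "[c + d * (-1 - t0) = 0] (mod int p)" unfolding 1 by (rule J(3))
      show "int p dvd (-1 - t0)^2 + (-1 - t0) + 1" unfolding 1 by (rule J(4))
      show "[(c - d - d * (-1 - t0)) * f ^ 3 = 1] (mod int p)" unfolding 1 by (rule J(5))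
      show "3 dvd d" "enorm c d = int p" using * J(1,2) enorm_conj by simp_all
    qed
  qed
  obtain c' d' where c': "eis c d ^ k = eis c' d'" "enorm c' d' = int p ^ k"
    using eis_power_ex enorm_power cd3 by metis
  have "int p ^ k * int b ^ 3 = int p ^ k * enorm u v"
    using enorm_mult[of x y c' d' u v] eq c' N by simp
  then have Nuv: "enorm u v = int b ^ 3" using p(1) by (auto simp: prime_gt_0_nat)
  have copuv: "coprime u v" using coprime_eis_factor[of x y c' d' u v] eq c' cop by simp
  from eis_cube_of_norm_cube[OF copuv Nuv b]
  obtain e u' v' where e: "e < 3" "eis u v = omega ^ e * eis u' v' ^ 3" by blast
  obtain m n where mn: "eis u' v' ^ 3 = eis m n" using eis_power_ex by blast
  obtain r s where rs: "eis c' d' * eis m n = eis r s" unfolding eis_mult by blast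
  have eq': "eis x y = omega ^ e * eis r s"
    unfolding eq c' e(2) mn rs[symmetric] by simp
  have "enorm u v = enorm m n"
  proof -
    obtain g h where gh: "omega ^ e = eis g h" "enorm g h = 1"
      using eis_power_ex[of 0 1 e] enorm_power[of 0 1 e] unfolding eis_omega
      by (auto simp: enorm_def)
    then show ?thesis using enorm_mult[of u v g h m n] e(2) mn by simp
  qed
  moreover have "\<not> 3 dvd int b" using b by presburger
  ultimately have "\<not> 3 dvd enorm m n" using Nuv three_dvd_power_iff[of 3 "int b"] by simp
  then have "\<not> 3 dvd enorm u' v'" using enorm_power[OF mn]
    by (simp add: three_dvd_power_iff)
  note mn3 = eis_cube_real_mod3[OF this mn]
  have d3: "3 dvd d'" using eis_power_real_mod3[OF cd3(1) c'(1)] .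
  have "\<not> 3 dvd enorm c' d'"
    unfolding c'(2) three_dvd_power_iff[OF k] using p(2) by presburger
  then have "\<not> 3 dvd c'" unfolding three_dvd_enorm_iff using d3 by (metis dvd_add)
  have rs': "r = c' * m - d' * n" "s = c' * n + d' * m - d' * n" using rs by (auto simp: eis_mult)
  have "3 dvd s" using rs' d3 mn3 by simp
  moreover have "\<not> 3 dvd r" using rs' d3 mn3 \<open>\<not> 3 dvd c'\<close>
    by (simp add: dvd_diff_left_iff three_dvd_prod_iff)
  moreover have "[r + s * t = 0] (mod int p)"
  proof -
    have "[r + s * t = (c' + d' * t) * (m + n * t)] (mod int p)"
      by (rule eval_mult[OF rs[symmetric] t(2)])
    moreover have "[c' + d' * t = (c + d * t) ^ k] (mod int p)"
      by (rule eval_power[OF c'(1)[symmetric] t(2)])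
    moreover have "int p dvd (c + d * t) ^ k" using t(1) k
      by (meson cong_0_iff dvd_power dvd_trans)
    ultimately show ?thesis by (metis cong_0_iff cong_dvd_iff dvd_mult2)
  qed
  \<comment> \<open>The cube of f^k cancels the k-th power of the conjugate prime; what remains is
    the cube of the conjugate of \<open>eis u' v'\<close> evaluated at t.\<close>
  moreover have "[(r - s - s * t) * (f ^ k) ^ 3 = (u' - v' - v' * t) ^ 3] (mod int p)"
  proof -
    have "eis (r-s) (-s) = eis (c'-d') (-d') * eis (m-n) (-n)"
      using arg_cong[OF rs, of cnj] by (simp add: eis_cnj)
    from eval_mult[OF this t(2)]
    have 1: "[r - s - s * t = (c' - d' - d' * t) * (m - n - n * t)] (mod int p)" by simp
    have "eis (c'-d') (-d') = eis (c-d) (-d) ^ k"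
      using arg_cong[OF c'(1), of cnj] by (simp add: eis_cnj)
    from eval_power[OF this t(2)]
    have 2: "[c' - d' - d' * t = (c - d - d * t) ^ k] (mod int p)" by simp
    have "eis (m-n) (-n) = eis (u'-v') (-v') ^ 3"
      using arg_cong[OF mn, of cnj] by (simp add: eis_cnj)
    from eval_power[OF this t(2)]
    have 3: "[m - n - n * t = (u' - v' - v' * t) ^ 3] (mod int p)" by simp
    have "[(r - s - s * t) * (f ^ k) ^ 3
        = ((c - d - d * t) ^ k * (u' - v' - v' * t) ^ 3) * (f ^ k) ^ 3] (mod int p)"
      by (intro cong_scalar_right cong_trans[OF 1] cong_mult 2 3)
    also have "((c - d - d * t) ^ k * (u' - v' - v' * t) ^ 3) * (f ^ k) ^ 3
        = ((c - d - d * t) * f ^ 3) ^ k * (u' - v' - v' * t) ^ 3"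
      by (simp add: power_mult_distrib power_mult[symmetric] mult.commute mult.left_commute)
    also have "[\<dots> = 1 ^ k * (u' - v' - v' * t) ^ 3] (mod int p)"
      by (intro cong_mult cong_pow t(3) cong_refl)
    finally show ?thesis by simp
  qed
  moreover have "\<not> int p dvd f ^ k"
  proof
    assume "int p dvd f ^ k"
    then have "int p dvd f" using p(1) prime_dvd_power by (metis prime_nat_int_transfer)
    then have "int p dvd (c - d - d * t) * f ^ 3" by (simp add: power3_eq_cube)
    then have "int p dvd 1" using t(3) cong_dvd_iff by blast
    then show False using p(1) by simp
  qed
  ultimately show ?thesis using e(1) eq' t(2) by blast
qed

text \<open>The inner binomial coefficients vanish modulo p, u and v are fixed by Fermat, and
  \<open>omega ^ p\<close> is the conjugate of \<omega> because p \<equiv> 2 modulo 3.\<close>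

lemma eis_frobenius:
  fixes p :: nat
  assumes p: "prime p" "p mod 3 = 2"
  shows "\<exists>c d. eis u v ^ p = cnj (eis u v) + of_int (int p) * eis c d"
proof -
  have binom: "\<exists>c d. eis a b * of_nat (p choose k) = of_int (int p) * eis c d"
    if k: "k \<in> {1..<p}" for k a b
  proof -
    have "p dvd (p choose k)" using k p(1) by (intro dvd_choose_prime) auto
    then obtain m where m: "p choose k = p * m" by blast
    have "eis a b * of_nat (p choose k) = of_int (int p) * eis (a * int m) (b * int m)"
      unfolding m eis_def by (simp add: algebra_simps)
    then show ?thesis by blast
  qed
  have sum_ex: "\<exists>c d. (\<Sum>k\<in>A. h k) = of_int (int p) * eis c d"
    if "finite A" "\<And>k. k \<in> A \<Longrightarrow> \<exists>c d. h k = of_int (int p) * eis c d" for A :: "nat set" and h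
    using that
  proof (induction A rule: finite_induct)
    case empty
    have "(\<Sum>k\<in>{}. h k) = of_int (int p) * eis 0 0" by (simp add: eis_def)
    then show ?case by blast
  next
    case (insert x A)
    then obtain c d c' d' where "(\<Sum>k\<in>A. h k) = of_int (int p) * eis c d"
      "h x = of_int (int p) * eis c' d'" by blast
    then have "(\<Sum>k\<in>insert x A. h k) = of_int (int p) * eis (c' + c) (d' + d)"
      using insert by (simp add: eis_add[symmetric] ring_distribs)
    then show ?case by blast
  qed
  have p0: "p > 0" using p(1) by (rule prime_gt_0_nat)
  let ?h = "\<lambda>k. of_nat (p choose k) * (of_int u) ^ k * (of_int v * omega) ^ (p - k)"
  have "\<exists>c d. ?h k = of_int (int p) * eis c d" if k: "k \<in> {1..<p}" for k
  proof -
    obtain a b where "eis u 0 ^ k * eis 0 v ^ (p - k) = eis a b"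
      using eis_power_ex by (metis eis_mult)
    then have ab: "of_int u ^ k * (of_int v * omega) ^ (p - k) = eis a b" by (simp add: eis_def)
    have "?h k = (of_int u ^ k * (of_int v * omega) ^ (p - k)) * of_nat (p choose k)"
      by (simp only: mult_ac)
    then have hk: "?h k = eis a b * of_nat (p choose k)" unfolding ab .
    show ?thesis unfolding hk by (rule binom[OF k])
  qed
  then obtain c d where cd: "(\<Sum>k\<in>{1..<p}. ?h k) = of_int (int p) * eis c d"
    using sum_ex[of "{1..<p}" ?h] by blast
  have "{..p} = insert 0 (insert p {1..<p})" using p0 by auto
  moreover have "eis u v ^ p = (\<Sum>k\<le>p. ?h k)"
    unfolding eis_def by (rule binomial_ring)
  ultimately have exp: "eis u v ^ p = of_int v ^ p * omega ^ p + of_int u ^ p + of_int (int p) * eis c d"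
    using cd p0 by (simp add: power_mult_distrib)
  obtain a where a: "u ^ p = u + int p * a"
    using fermat_int_power[OF p(1), of u] by (metis cong_iff_lin cong_sym)
  obtain b where b: "v ^ p = v + int p * b"
    using fermat_int_power[OF p(1), of v] by (metis cong_iff_lin cong_sym)
  have "omega ^ p = (omega ^ 3) ^ (p div 3) * omega ^ 2"
    using p(2) by (metis mult_div_mod_eq power_add power_mult)
  then have om: "omega ^ p = -1 - omega" by (simp add: omega_cube power2_eq_square omega_sq)
  have "(of_int v :: complex) ^ p = of_int (v + int p * b)" "(of_int u :: complex) ^ p = of_int (u + int p * a)"
    using a b by (metis of_int_power)+
  then have "eis u v ^ p = cnj (eis u v) + of_int (int p) * eis (c - b + a) (d - b)"
    unfolding exp om by (simp add: eis_def cnj_omega algebra_simps)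
  then show ?thesis by blast
qed

section \<open>Congruence obstructions\<close>

lemma int_cube_inject: "a ^ 3 = b ^ 3 \<Longrightarrow> a = (b::int)"
proof -
  assume "a ^ 3 = b ^ 3"
  then have "(real_of_int a) ^ 3 = (real_of_int b) ^ 3" by (metis of_int_power)
  then have "root 3 (real_of_int a ^ 3) = root 3 (real_of_int b ^ 3)" by simp
  then show "a = b" by (simp add: odd_real_root_power_cancel)
qed

text \<open>Signs are harmless because -1 is a cube; if one factor is 0, coprimality makes the other
  a unit.\<close>

lemma coprime_mult_cubeD:
  fixes A B Z :: int
  assumes cop: "coprime A B" and eq: "A * B = Z ^ 3"
  shows "\<exists>a b. A = a ^ 3 \<and> B = b ^ 3"
proof (cases "A = 0 \<or> B = 0")
  case True
  have u: "\<exists>a. x = a ^ 3" if "is_unit x" for x :: int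
  proof -
    have "x = 1 \<or> x = -1" using that by (auto simp: abs_if split: if_splits)
    then show ?thesis by (intro exI[of _ x]) auto
  qed
  have "\<exists>a. (0::int) = a ^ 3" by (intro exI[of _ 0]) simp
  then show ?thesis using True cop u[of A] u[of B] by auto
next
  case False
  have "coprime (nat \<bar>A\<bar>) (nat \<bar>B\<bar>)" using cop by (simp add: coprime_int_iff[symmetric])
  moreover have "nat \<bar>A\<bar> * nat \<bar>B\<bar> = nat \<bar>Z\<bar> ^ 3"
    using eq by (simp add: nat_mult_distrib[symmetric] abs_mult[symmetric] nat_power_eq[symmetric] power_abs)
  then have "is_nth_power 3 (nat \<bar>A\<bar> * nat \<bar>B\<bar>)" by (metis is_nth_powerI)
  ultimately have "is_nth_power 3 (nat \<bar>A\<bar>)" "is_nth_power 3 (nat \<bar>B\<bar>)"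
    using is_nth_power_mult_coprime_natD[of "nat \<bar>A\<bar>" "nat \<bar>B\<bar>" 3] False by auto
  then obtain a b where "nat \<bar>A\<bar> = a ^ 3" "nat \<bar>B\<bar> = b ^ 3" by (metis is_nth_powerE)
  then have "\<bar>A\<bar> = int a ^ 3" "\<bar>B\<bar> = int b ^ 3" by (simp_all add: eq_nat_nat_iff flip: of_nat_power)
  then have "A = (sgn A * int a) ^ 3" "B = (sgn B * int b) ^ 3"
    using False by (auto simp: sgn_if power_mult_distrib abs_if split: if_splits)
  then show ?thesis by blast
qed

lemma prime_power_dvd_coprime_mult:
  fixes A B p :: int
  assumes "prime p" "coprime A B" "p ^ k dvd A * B"
  shows "p ^ k dvd A \<or> p ^ k dvd B"
proof (cases "p dvd A")
  case True
  then have "\<not> p dvd B" using assms(1,2) coprime_common_divisor not_prime_unit by blast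
  then have "coprime (p ^ k) B" using assms(1) by (simp add: prime_imp_coprime)
  then show ?thesis using assms(3) by (simp add: coprime_dvd_mult_left_iff)
next
  case False
  then have "coprime (p ^ k) A" using assms(1) by (simp add: prime_imp_coprime)
  then show ?thesis using assms(3) by (simp add: coprime_dvd_mult_right_iff)
qed

lemma cube_mod_9_cases:
  fixes x :: int
  shows "x^3 mod 9 = 0 \<and> 3 dvd x \<or> x^3 mod 9 = 1 \<and> \<not> 3 dvd x \<or> x^3 mod 9 = 8 \<and> \<not> 3 dvd x"
proof -
  define k r where "k = x div 3" and "r = x mod 3"
  have x: "x = 3 * k + r" by (simp add: k_def r_def)
  have "x^3 = r^3 + 9 * (3 * k^3 + 3 * k^2 * r + k * r^2)"
    unfolding x by (simp add: algebra_simps power2_eq_square power3_eq_cube)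
  then have "x^3 mod 9 = r^3 mod 9" by (simp only: mod_mult_self2)
  moreover have "r = 0 \<and> 3 dvd x \<or> r = 1 \<and> \<not> 3 dvd x \<or> r = 2 \<and> \<not> 3 dvd x"
    unfolding r_def by presburger
  ultimately show ?thesis by (elim disjE conjE) simp_all
qed

text \<open>Otherwise 3 divides exactly one of X and Y, so the sum of cubes is 1 or -1 modulo 9, and
  hence so is n.\<close>

lemma sum_cubes_three_dvd_diff:
  fixes X Y Z n :: int
  assumes eq: "X^3 + Y^3 = n * Z^3" and n: "n mod 9 \<noteq> 1" "n mod 9 \<noteq> 8"
    and s: "\<not> 3 dvd X + Y"
  shows "3 dvd X - Y"
proof (rule ccontr)
  assume d: "\<not> 3 dvd X - Y"
  have sum: "(a + b) mod 9 = 1 \<or> (a + b) mod 9 = 8"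
    if "a = 0 \<and> (b = 1 \<or> b = 8) \<or> b = 0 \<and> (a = 1 \<or> a = 8)" for a b :: int
    using that by auto
  have "X^3 mod 9 = 0 \<and> (Y^3 mod 9 = 1 \<or> Y^3 mod 9 = 8) \<or>
        Y^3 mod 9 = 0 \<and> (X^3 mod 9 = 1 \<or> X^3 mod 9 = 8)"
  proof (cases "3 dvd X")
    case True
    then have "\<not> 3 dvd Y" using s by presburger
    then show ?thesis using True cube_mod_9_cases[of X] cube_mod_9_cases[of Y] by blast
  next
    case False
    have "X mod 3 = 0 \<or> X mod 3 = 1 \<or> X mod 3 = 2" "Y mod 3 = 0 \<or> Y mod 3 = 1 \<or> Y mod 3 = 2"
      by presburger+
    then have "3 dvd Y" using False s d by (elim disjE) presburger+
    then show ?thesis using False cube_mod_9_cases[of X] cube_mod_9_cases[of Y] by blast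
  qed
  from sum[OF this] have 1: "(X^3 + Y^3) mod 9 = 1 \<or> (X^3 + Y^3) mod 9 = 8" unfolding mod_add_eq .
  have 2: "(n * Z^3) mod 9 = (n * (Z^3 mod 9)) mod 9" by (rule mod_mult_right_eq[symmetric])
  have n18: "n mod 9 = 1 \<or> n mod 9 = 8"
    if "c = 0 \<or> c = 1 \<or> c = 8" "(n * c) mod 9 = 1 \<or> (n * c) mod 9 = 8" for c
    using that(1)
  proof (elim disjE)
    assume "c = 8"
    \<comment> \<open>8 is its own inverse modulo 9: 8 * 8n = n + 63n.\<close>
    have "n mod 9 = (n + 9 * (7 * n)) mod 9" by (simp only: mod_mult_self2)
    also have "n + 9 * (7 * n) = 8 * (n * c)" using \<open>c = 8\<close> by simp
    also have "(8 * (n * c)) mod 9 = (8 * ((n * c) mod 9)) mod 9"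
      by (rule mod_mult_right_eq[symmetric])
    finally have *: "n mod 9 = (8 * ((n * c) mod 9)) mod 9" .
    from that(2) show ?thesis by (rule disjE) (simp_all only: *, simp_all)
  qed (use that(2) in simp_all)
  have Z: "Z^3 mod 9 = 0 \<or> Z^3 mod 9 = 1 \<or> Z^3 mod 9 = 8"
    using cube_mod_9_cases[of Z] by blast
  have "(n * (Z^3 mod 9)) mod 9 = 1 \<or> (n * (Z^3 mod 9)) mod 9 = 8"
    using 1 unfolding eq 2 .
  from n18[OF Z this] show False using n by simp
qed

text \<open>A finite check, cubes being 0, 1 or -1 modulo 9. The pairs are the residues of the two
  prime powers in cases (1) and (2).\<close>

lemma ternary_mod_9:
  fixes x y z P Q :: int
  assumes eq: "x^3 + P * y^3 + Q * z^3 = 0"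
    and PQ: "(P mod 9, Q mod 9) \<in> {(2,5),(4,7),(4,2),(7,5)}"
  shows "3 dvd x \<and> 3 dvd y"
proof -
  have "(x^3 + P * y^3 + Q * z^3) mod 9
      = (x^3 mod 9 + (P mod 9) * (y^3 mod 9) + (Q mod 9) * (z^3 mod 9)) mod 9"
    by (intro mod_add_cong mod_mult_cong) simp_all
  then have 0: "(x^3 mod 9 + (P mod 9) * (y^3 mod 9) + (Q mod 9) * (z^3 mod 9)) mod 9 = 0"
    using eq by simp
  have *: "a = 0 \<and> b = 0"
    if "a \<in> {0,1,8}" "b \<in> {0,1,8}" "c \<in> {0,1,8}" "(u,v) \<in> {(2,5),(4,7),(4,2),(7,5)}"
      "(a + u * b + v * c) mod 9 = 0" for a b c u v :: int
    using that by (elim insertE emptyE) simp_all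
  have "x^3 mod 9 \<in> {0,1,8}" "y^3 mod 9 \<in> {0,1,8}" "z^3 mod 9 \<in> {0,1,8}"
    using cube_mod_9_cases[of x] cube_mod_9_cases[of y] cube_mod_9_cases[of z] by auto
  from *[OF this PQ 0] have "x^3 mod 9 = 0 \<and> y^3 mod 9 = 0" .
  then show ?thesis using cube_mod_9_cases[of x] cube_mod_9_cases[of y] by auto
qed

text \<open>Dividing by c^3 makes q^j a cube modulo p; for j = 2 one recovers q as (q^2)^2 /
  q^3.\<close>

lemma cubic_residue_of_power:
  fixes p q j :: nat
  assumes p: "prime p" and j: "j = 1 \<or> j = 2" and q: "\<not> p dvd q"
    and c: "\<not> int p dvd c" and cong: "[int q ^ j * c ^ 3 = d ^ 3] (mod int p)"
  shows "\<exists>x::nat. [x ^ 3 = q] (mod p)"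
proof -
  have inv: "\<exists>z'. [z * z' = 1] (mod int p)" if "\<not> int p dvd z" for z
    using that p prime_imp_coprime[of "int p" z]
    by (intro cong_solve_coprime_int) (simp add: coprime_commute)
  obtain c' where c': "[c * c' = 1] (mod int p)" using inv c by blast
  obtain q' where q': "[int q * q' = 1] (mod int p)" using inv q by (meson int_dvd_int_iff)
  define e where "e = d * c'"
  have "[int q ^ j * (c * c') ^ 3 = int q ^ j * 1 ^ 3] (mod int p)"
    by (intro cong_mult cong_pow c' cong_refl)
  moreover have "[int q ^ j * (c * c') ^ 3 = e ^ 3] (mod int p)"
    using cong_scalar_right[OF cong, of "c' ^ 3"] by (simp add: e_def power_mult_distrib mult.assoc)
  ultimately have e: "[int q ^ j = e ^ 3] (mod int p)" using cong_sym cong_trans by fastforce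
  have "\<exists>f. [f ^ 3 = int q] (mod int p)"
    using j
  proof
    assume "j = 1" then show ?thesis using e cong_sym by fastforce
  next
    assume j: "j = 2"
    have "[(e^2 * q')^3 = (int q ^ 2)^2 * q' ^ 3] (mod int p)"
      using cong_scalar_right[OF cong_pow[OF e[unfolded j], of 2], of "q' ^ 3"]
      by (simp add: power_mult_distrib power_mult[symmetric] cong_sym)
    also have "(int q ^ 2)^2 * q' ^ 3 = int q * (int q * q') ^ 3"
      by (simp add: power2_eq_square power3_eq_cube)
    also have "[\<dots> = int q * 1 ^ 3] (mod int p)" by (intro cong_mult cong_pow q' cong_refl)
    finally show ?thesis by auto
  qed
  then obtain f where f: "[f ^ 3 = int q] (mod int p)" by blast
  have "[int (nat (f mod int p)) ^ 3 = int q] (mod int p)"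
    using f prime_gt_0_nat[OF p] by (simp add: cong_def power_mod)
  then have "[nat (f mod int p) ^ 3 = q] (mod p)" by (metis cong_int_iff of_nat_power)
  then show ?thesis by blast
qed

section \<open>Congruences modulo a rational integer, and inert primes\<close>

definition eis_cong :: "int \<Rightarrow> complex \<Rightarrow> complex \<Rightarrow> bool" where
  "eis_cong P z w \<longleftrightarrow> (\<exists>c d. z = w + of_int P * eis c d)"

text \<open>Coordinates of w and w' are supplied because \<open>eis_cong\<close> does not record
  that its arguments lie in Z[\<omega>].\<close>

lemma eis_cong_mult:
  assumes "eis_cong P z w" "eis_cong P z' w'" "w = eis a b" "w' = eis a' b'"
  shows "eis_cong P (z * z') (w * w')"
proof -
  obtain c d c' d' where *: "z = w + of_int P * eis c d" "z' = w' + of_int P * eis c' d'"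
    using assms by (auto simp: eis_cong_def)
  have "z * z' = w * w' + of_int P * (w * eis c' d' + eis c d * w' + of_int P * (eis c d * eis c' d'))"
    unfolding * by (simp add: algebra_simps)
  then show ?thesis unfolding assms(3,4) eis_cong_def eis_int eis_mult eis_add by blast
qed

lemma eis_cong_refl: "eis_cong P z z"
  unfolding eis_cong_def by (rule exI[of _ 0], rule exI[of _ 0]) (simp add: eis_def)

lemma eis_cong_power:
  assumes "eis_cong P z w" "w = eis a b"
  shows "eis_cong P (z ^ m) (w ^ m)"
proof (induction m)
  case 0 then show ?case by (simp add: eis_cong_refl)
next
  case (Suc m)
  obtain a' b' where "w ^ m = eis a' b'" using eis_power_ex assms(2) by blast
  from eis_cong_mult[OF assms(1) Suc assms(2) this] show ?case by simp
qed

lemma eis_cong_trans: "eis_cong P x y \<Longrightarrow> eis_cong P y z \<Longrightarrow> eis_cong P x z"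
  unfolding eis_cong_def by (auto simp: add.assoc ring_distribs(1)[symmetric] eis_add)

lemma eis_cong_sym: "eis_cong P x y \<Longrightarrow> eis_cong P y x"
proof -
  assume "eis_cong P x y"
  then obtain c d where "x = y + of_int P * eis c d" by (auto simp: eis_cong_def)
  then have "y = x + of_int P * eis (-c) (-d)" by (simp add: eis_minus[symmetric])
  then show ?thesis by (auto simp: eis_cong_def)
qed

lemma omega_power_mod: "omega ^ f = omega ^ (f mod 3)"
proof -
  have "omega ^ f = (omega ^ 3) ^ (f div 3) * omega ^ (f mod 3)"
    by (metis mult_div_mod_eq power_add power_mult)
  then show ?thesis by (simp add: omega_cube)
qed

text \<open>Write \<open>\<alpha> = X + Y\<omega>\<close> and \<open>\<alpha>'\<close> for its conjugate, so \<open>X + Y = - \<omega>\<alpha> - \<omega>\<^sup>2\<alpha>'\<close>. Raising the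
  congruence \<open>\<omega>\<alpha> \<equiv> - \<omega>\<^sup>2\<alpha>'\<close> modulo \<open>p\<close> to the power \<open>(p+1)/3\<close> turns the cubes into
  \<open>(p+1)\<close>-st powers, which are norms by Frobenius; what remains is the norm times a difference of
  distinct powers of \<open>\<omega>\<close> up to sign.\<close>

lemma inert_prime_dvd_norm:
  fixes p :: nat
  assumes p: "prime p" "p mod 9 = 2 \<or> p mod 9 = 5"
    and eq: "eis X Y = omega ^ s * eis u v ^ 3" and s: "s < 2" and dvd: "int p dvd X + Y"
  shows "int p dvd enorm u v"
proof -
  define m where "m = (p + 1) div 3"
  define \<beta> where "\<beta> = eis u v"
  define f where "f = (s + 1) * m"
  \<comment> \<open>Here p \<equiv> 2, 5 modulo 9 enters: it makes m prime to 3, which p \<equiv> 8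
    would not.\<close>
  have pm: "p + 1 = 3 * m" and mm: "m mod 3 = 1 \<or> m mod 3 = 2"
    using p(2) unfolding m_def by presburger+
  have p3: "p mod 3 = 2" using p(2) by presburger
  \<comment> \<open>As s < 2, also s + 1 is prime to 3; so the exponents f and 2f of \<omega> differ
    modulo 3.\<close>
  have f: "f mod 3 = 1 \<or> f mod 3 = 2"
    using mm s unfolding f_def by (cases "s = 0") (auto simp: mod_mult_right_eq[symmetric] less_2_cases_iff, presburger+)
  have cb: "cnj \<beta> = eis (u - v) (- v)" by (simp add: \<beta>_def eis_cnj)
  have N: "\<beta> * cnj \<beta> = of_int (enorm u v)" by (simp add: \<beta>_def eis_norm)
  have cnj_om: "cnj omega = omega ^ 2" by (simp add: cnj_omega power2_eq_square omega_sq)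
  have cnj_oms: "cnj omega ^ s = omega ^ (2 * s)" by (simp add: cnj_om power_mult)
  define z where "z = omega ^ (s+1) * \<beta> ^ 3"
  define w where "w = - (omega ^ (2*(s+1)) * cnj \<beta> ^ 3)"
  have om2: "omega ^ 2 = eis (-1) (-1)" by (simp add: eis_def power2_eq_square omega_sq)
  have "omega * eis X Y + omega ^ 2 * cnj (eis X Y) = of_int (- (X + Y))"
    unfolding eis_cnj om2 by (simp add: eis_omega eis_mult eis_add eis_int)
  moreover have "omega * eis X Y = z" unfolding z_def eq \<beta>_def by simp
  moreover have "omega ^ 2 * cnj (eis X Y) = - w"
    unfolding w_def eq \<beta>_def by (simp add: cnj_oms power_add power2_eq_square)
  ultimately have zw: "z - w = of_int (- (X + Y))" by simp
  obtain a where a: "X + Y = int p * a" using dvd by blast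
  have "z = w + of_int (int p) * eis (- a) 0" using zw unfolding a by (simp add: eis_def algebra_simps)
  then have cong: "eis_cong (int p) z w" unfolding eis_cong_def by blast
  have "\<exists>c d. w = eis c d"
  proof -
    obtain a b a' b' where "omega ^ (2*(s+1)) = eis a b" "cnj \<beta> ^ 3 = eis a' b'"
      using eis_omega_power_ex eis_power_ex cb by metis
    then show ?thesis unfolding w_def eis_mult eis_minus by (metis eis_minus eis_mult)
  qed
  then have c1: "eis_cong (int p) (z ^ m) (w ^ m)" using eis_cong_power[OF cong] by blast
  have frob: "eis_cong (int p) (eis a b ^ (p + 1)) (of_int (enorm a b))" for a b
  proof -
    have "eis_cong (int p) (eis a b ^ p) (cnj (eis a b))"
      unfolding eis_cong_def by (rule eis_frobenius[OF p(1) p3])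
    then have "eis_cong (int p) (eis a b * eis a b ^ p) (eis a b * cnj (eis a b))"
      by (rule eis_cong_mult[OF eis_cong_refl _ refl eis_cnj])
    then show ?thesis by (simp add: eis_norm)
  qed
  have scal: "eis_cong (int p) (omega ^ k * x) (omega ^ k * of_int n)"
    if "eis_cong (int p) x (of_int n)" for k x n
  proof -
    obtain a b where "omega ^ k = eis a b" using eis_omega_power_ex by blast
    from eis_cong_mult[OF eis_cong_refl that this eis_int] show ?thesis .
  qed
  have zm: "z ^ m = omega ^ f * \<beta> ^ (p + 1)"
    unfolding z_def f_def pm by (simp only: power_mult_distrib power_mult[symmetric])
  have c2: "eis_cong (int p) (z ^ m) (omega ^ f * of_int (enorm u v))"
    unfolding zm by (rule scal) (simp only: \<beta>_def frob)
  have wm: "w ^ m = omega ^ (2 * f) * ((-1) ^ m * cnj \<beta> ^ (p + 1))"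
  proof -
    have "w ^ m = (-1) ^ m * (omega ^ (2*(s+1)) * cnj \<beta> ^ 3) ^ m"
      unfolding w_def by (rule power_minus)
    also have "\<dots> = omega ^ (2 * f) * ((-1) ^ m * cnj \<beta> ^ (p + 1))"
      unfolding f_def pm
      by (simp only: power_mult_distrib power_mult[symmetric] mult.left_commute mult.assoc)
    finally show ?thesis .
  qed
  have "eis_cong (int p) (cnj \<beta> ^ (p + 1)) (of_int (enorm u v))"
    using frob[of "u - v" "- v"] by (simp add: cb enorm_conj)
  from eis_cong_mult[OF eis_cong_refl this, of "(-1) ^ m" "(-1) ^ m" 0]
  have "eis_cong (int p) ((-1) ^ m * cnj \<beta> ^ (p + 1)) (of_int ((-1) ^ m * enorm u v))"
    by (simp add: eis_def) (metis add.right_neutral mult_zero_left of_int_0)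
  from scal[OF this, of "2 * f"] have c3: "eis_cong (int p) (w ^ m) (omega ^ (2 * f) * of_int ((-1) ^ m * enorm u v))"
    unfolding wm .
  have "eis_cong (int p) (omega ^ f * of_int (enorm u v)) (omega ^ (2 * f) * of_int ((-1) ^ m * enorm u v))"
    using c1 c2 c3 eis_cong_trans eis_cong_sym by blast
  then obtain c d where cd: "omega ^ f * of_int (enorm u v)
      = omega ^ (2 * f) * of_int ((-1) ^ m * enorm u v) + of_int (int p) * eis c d"
    by (auto simp: eis_cong_def)
  define \<epsilon> :: int where "\<epsilon> = (-1) ^ m"
  have \<epsilon>: "\<epsilon> = 1 \<or> \<epsilon> = -1" unfolding \<epsilon>_def by (cases "even m") auto
  show ?thesis
    using f
  proof
    assume f1: "f mod 3 = 1"
    then have "(2 * f) mod 3 = 2" by presburger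
    then have "omega ^ f = eis 0 1" "omega ^ (2 * f) = eis (-1) (-1)"
      using omega_power_mod[of f] omega_power_mod[of "2*f"] f1
      by (simp_all add: eis_def power2_eq_square omega_sq)
    \<comment> \<open>The first coordinate isolates the norm up to sign.\<close>
    then have "eis 0 (enorm u v) = eis (- \<epsilon> * enorm u v + int p * c) (- \<epsilon> * enorm u v + int p * d)"
      using cd unfolding \<epsilon>_def[symmetric] eis_int by (simp only: eis_mult eis_add) simp
    then have "\<epsilon> * enorm u v = int p * c" by simp
    then have "int p dvd \<epsilon> * enorm u v" by simp
    then show ?thesis using \<epsilon> by auto
  next
    assume f2: "f mod 3 = 2"
    then have "(2 * f) mod 3 = 1" by presburger
    then have "omega ^ f = eis (-1) (-1)" "omega ^ (2 * f) = eis 0 1"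
      using omega_power_mod[of f] omega_power_mod[of "2*f"] f2
      by (simp_all add: eis_def power2_eq_square omega_sq)
    then have "eis (- enorm u v) (- enorm u v) = eis (int p * c) (\<epsilon> * enorm u v + int p * d)"
      using cd unfolding \<epsilon>_def[symmetric] eis_int by (simp only: eis_mult eis_add) simp
    then have "- enorm u v = int p * c" by simp
    then have "int p dvd - enorm u v" by simp
    then show ?thesis by simp
  qed
qed

section \<open>Descent for sums of two cubes\<close>

lemma dvd_three_of_coprime:
  fixes u v c :: int
  assumes "coprime u v" "c dvd 3 * u" "c dvd 3 * v"
  shows "c dvd 3"
proof -
  have "c dvd gcd (3 * u) (3 * v)" using assms by simp
  also have "gcd (3 * u) (3 * v) = 3" using assms(1) by (simp add: gcd_mult_left)
  finally show ?thesis .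
qed

lemma coprime_of_coprime_cube:
  assumes "eis x y = omega ^ s * eis u v ^ 3" "coprime x y"
  shows "coprime u v"
proof -
  obtain a b where "omega ^ s * eis u v ^ 2 = eis a b"
    using eis_omega_power_ex[of s] eis_power_ex[of u v 2] by (metis eis_mult)
  moreover have "eis x y = (omega ^ s * eis u v ^ 2) * eis u v"
    unfolding assms(1) by (simp add: power2_eq_square power3_eq_cube)
  ultimately show ?thesis using coprime_eis_factor[of x y a b u v] assms(2) by simp
qed

lemma enorm_omega_cube:
  assumes "eis x y = omega ^ s * eis u v ^ 3"
  shows "enorm x y = enorm u v ^ 3"
proof -
  obtain a b where ab: "omega ^ s = eis a b" using eis_omega_power_ex by blast
  have "enorm a b = 1" using enorm_power[of 0 1 s a b] ab unfolding eis_omega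
    by (simp add: enorm_def)
  moreover obtain c d where cd: "eis u v ^ 3 = eis c d" using eis_power_ex by blast
  ultimately show ?thesis using enorm_mult[of x y a b c d] enorm_power[OF cd] assms ab by simp
qed

text \<open>Common setting of the four cases, with q inert. \<open>no_ternary\<close> is the local
  insolubility; \<open>p_type\<close> separates an inert p, treated by Frobenius, from a split p,
  treated by the Jacobi sum.\<close>

locale cube_sum =
  fixes p q i j :: nat
  assumes p: "prime p" and q: "prime q" and pq: "p \<noteq> q" and p3: "p \<noteq> 3" and q3: "q mod 3 = 2"
    and i: "i > 0" and j: "j = 1 \<or> j = 2"
    and cubefree: "\<And>g. prime g \<Longrightarrow> \<not> g ^ 3 dvd p ^ i * q ^ j"
    and no_ternary: "\<And>x y z :: int. coprime x (int p * y) \<Longrightarrow> coprime x (int q * z) \<Longrightarrow>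
      coprime (int p * y) (int q * z) \<Longrightarrow> x^3 + int p ^ i * y^3 + int q ^ j * z^3 \<noteq> 0"
    and p_type: "p mod 9 = 2 \<or> p mod 9 = 5 \<or>
      p mod 3 = 1 \<and> \<not> (\<exists>x::nat. [x^3 = q] (mod p)) \<and>
      (p ^ i * q ^ j) mod 9 \<noteq> 1 \<and> (p ^ i * q ^ j) mod 9 \<noteq> 8"
begin

abbreviation n :: int where "n \<equiv> int p ^ i * int q ^ j"

lemma pP: "prime (int p)" and qP: "prime (int q)" using p q by simp_all
lemma pq_pos [simp]: "p > 0" "q > 0" "p \<noteq> 0" "q \<noteq> 0"
  using prime_gt_0_nat[OF p] prime_gt_0_nat[OF q] by simp_all
lemma j0: "j > 0" using j by auto

lemma coprime_pq: "coprime (int p ^ i) (int q ^ j)"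
  using primes_coprime[OF p q pq] by simp

lemma n_pos: "n > 0" using p q by (simp add: prime_gt_0_nat)

lemma n_gt_2: "n > 2"
proof -
  have "p \<ge> 2" "q \<ge> 2" using p q by (simp_all add: prime_ge_2_nat)
  then have "2 * 2 \<le> p * q" by (rule mult_le_mono)
  then have pq6: "p * q > 2" by simp
  have "p * q dvd p ^ i * q ^ j" using i j0 by (intro mult_dvd_mono dvd_power) auto
  then have "p * q \<le> p ^ i * q ^ j" using p q by (intro dvd_imp_le) (auto simp: prime_gt_0_nat)
  with pq6 have "int 2 < int (p ^ i * q ^ j)" by (simp only: of_nat_less_iff)
  then show ?thesis by simp
qed

lemma not_3_dvd_n: "\<not> 3 dvd n"
proof
  assume "3 dvd n"
  then have "int 3 dvd int p \<or> int 3 dvd int q"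
    using three_dvd_prod_iff three_dvd_power_iff i j0 by simp
  then have "3 dvd p \<or> 3 dvd q" by (simp only: int_dvd_int_iff)
  then show False using p3 q3 primes_dvd_imp_eq[of 3 p] p by auto
qed

lemma q_noncube: "p mod 3 = 1 \<Longrightarrow> \<not> (\<exists>x::nat. [x^3 = q] (mod p))"
  and n_mod_9: "p mod 3 = 1 \<Longrightarrow> n mod 9 \<noteq> 1 \<and> n mod 9 \<noteq> 8"
proof -
  assume "p mod 3 = 1"
  then have "p mod 9 \<noteq> 2" "p mod 9 \<noteq> 5" by presburger+
  with p_type have *: "\<not> (\<exists>x::nat. [x^3 = q] (mod p))"
    "(p ^ i * q ^ j) mod 9 \<noteq> 1" "(p ^ i * q ^ j) mod 9 \<noteq> 8" by auto
  then show "\<not> (\<exists>x::nat. [x^3 = q] (mod p))" by blast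
  have "n mod 9 = int ((p ^ i * q ^ j) mod 9)" by (simp add: zmod_int)
  then show "n mod 9 \<noteq> 1 \<and> n mod 9 \<noteq> 8" using * by simp
qed

lemma not_cube_multiple:
  assumes "p mod 3 = 1" "\<not> int p dvd c" "[int q ^ j * c ^ 3 = d ^ 3] (mod int p)"
  shows False
proof -
  have "\<not> p dvd q" using p q pq primes_dvd_imp_eq by blast
  then show ?thesis using cubic_residue_of_power[OF p j _ assms(2,3)] q_noncube[OF assms(1)] by blast
qed

text \<open>A is X + Y and B the norm, up to powers of 3. All of \<open>q ^ j\<close> goes to A, and
  \<open>p ^ i\<close> goes as a whole to one side; the coprime cofactors are then cubes. In the
  first outcome Z = a b will bound the descent.\<close>

lemma norm_factorization:
  assumes cop: "coprime A B" and eq: "A * B = n * Z ^ 3" and B: "B > 0" and qB: "\<not> int q dvd B"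
    and Z: "Z \<noteq> 0"
  obtains a b where "B = int b ^ 3" "A = n * a ^ 3" "Z = a * int b"
  | a b where "int p dvd B" "B = int p ^ i * int b ^ 3" "A = int q ^ j * a ^ 3"
proof -
  have "coprime (int q ^ j) B" using prime_imp_coprime[OF qP qB] by simp
  moreover have "int q ^ j dvd A * B" unfolding eq by simp
  ultimately have "int q ^ j dvd A" by (simp add: coprime_dvd_mult_left_iff)
  then obtain A1 where A1: "A = int q ^ j * A1" by blast
  have "int q ^ j \<noteq> 0" using q by simp
  then have e1: "A1 * B = int p ^ i * Z ^ 3" using eq unfolding A1 by simp
  have c1: "coprime A1 B" using cop unfolding A1 by simp
  have p0: "int p ^ i \<noteq> 0" using p by simp
  have "int p ^ i dvd A1 * B" unfolding e1 by simp
  then consider "int p ^ i dvd B" | "int p ^ i dvd A1"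
    using prime_power_dvd_coprime_mult[OF pP c1] by blast
  then show ?thesis
  proof cases
    case 1
    then obtain B1 where B1: "B = int p ^ i * B1" by blast
    then have "A1 * B1 = Z ^ 3" using e1 p0 by simp
    moreover have "coprime A1 B1" using c1 unfolding B1 by simp
    ultimately obtain a b where ab: "A1 = a ^ 3" "B1 = b ^ 3" using coprime_mult_cubeD by blast
    have "int p ^ i > 0" by simp
    then have "b ^ 3 > 0" using B unfolding B1 ab by (simp only: zero_less_mult_iff) auto
    then have "b > 0" by (simp add: zero_less_power_eq)
    then have "B = int p ^ i * int (nat b) ^ 3" using B1 ab by simp
    moreover have "int p dvd B" using i unfolding B1 by (simp add: dvd_mult2 dvd_power)
    ultimately show ?thesis using that(2) A1 ab by blast
  next
    case 2
    then obtain A2 where A2: "A1 = int p ^ i * A2" by blast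
    then have e: "A2 * B = Z ^ 3" using e1 p0 by simp
    moreover have "coprime A2 B" using c1 unfolding A2 by simp
    ultimately obtain a b where ab: "A2 = a ^ 3" "B = b ^ 3" using coprime_mult_cubeD by blast
    have "b > 0" using B unfolding ab by (simp add: zero_less_power_eq)
    then have "B = int (nat b) ^ 3" using ab by simp
    moreover have "A = n * a ^ 3" using A1 A2 ab by simp
    moreover have "(a * int (nat b)) ^ 3 = Z ^ 3"
      using e ab \<open>b > 0\<close> by (simp add: power_mult_distrib)
    then have "Z = a * int (nat b)" using int_cube_inject by metis
    ultimately show ?thesis using that(1) by blast
  qed
qed

text \<open>With \<open>p ^ i\<close> and \<open>q ^ j\<close> in different terms, cancelling them
  leaves three coprime cubes, and the vanishing sum is the equation excluded by
  \<open>no_ternary\<close>.\<close>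

lemma no_split_triple:
  assumes sum: "f1 + f2 + f3 = 0" and cop: "coprime f1 f2" "coprime f1 f3" "coprime f2 f3"
    and prod: "f1 * f2 * f3 = n * a ^ 3" and f1: "int p ^ i dvd f1" and f2: "int q ^ j dvd f2"
  shows False
proof -
  obtain g h where gh: "f1 = int p ^ i * g" "f2 = int q ^ j * h" using f1 f2 by blast
  have nz: "int p ^ i \<noteq> 0" "int q ^ j \<noteq> 0" using p q by simp_all
  have "n * (g * h * f3) = n * a ^ 3" using prod unfolding gh by (simp add: mult_ac)
  then have e: "(g * h) * f3 = a ^ 3" using nz by simp
  have c: "coprime g h" "coprime g f3" "coprime h f3" using cop unfolding gh by simp_all
  then have "coprime (g * h) f3" by simp
  then obtain x m where "g * h = m ^ 3" and x: "f3 = x ^ 3" using coprime_mult_cubeD[OF _ e] by blast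
  then obtain y z where yz: "g = y ^ 3" "h = z ^ 3" using coprime_mult_cubeD[OF c(1)] by blast
  have "coprime (x ^ 3) (int p ^ i * y ^ 3)" "coprime (x ^ 3) (int q ^ j * z ^ 3)"
    "coprime (int p ^ i * y ^ 3) (int q ^ j * z ^ 3)"
    using cop unfolding gh yz x by (simp_all add: coprime_commute)
  then have "coprime x (int p * y)" "coprime x (int q * z)" "coprime (int p * y) (int q * z)"
    using i j0 by simp_all
  moreover have "x^3 + int p ^ i * y^3 + int q ^ j * z^3 = 0"
    using sum unfolding gh yz x by simp
  ultimately show False using no_ternary by blast
qed

text \<open>If \<open>q ^ j\<close> divides f1 as well, f1 is n times a cube and f2, f3 are cubes: a
  new solution, with a sign from moving f1 across.\<close>

lemma triple_core:
  assumes sum: "f1 + f2 + f3 = 0" and cop: "coprime f1 f2" "coprime f1 f3" "coprime f2 f3"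
    and prod: "f1 * f2 * f3 = n * a ^ 3" and f1: "int p ^ i dvd f1"
  shows "\<exists>a1 a2 a3. a1 ^ 3 + a2 ^ 3 = n * a3 ^ 3 \<and> \<bar>a1 * a2 * a3\<bar> = \<bar>a\<bar>"
proof -
  have "int q ^ j dvd f1 * (f2 * f3)" using prod by (simp add: mult.assoc)
  then have "int q ^ j dvd f1 \<or> int q ^ j dvd f2 * f3"
    using prime_power_dvd_coprime_mult[OF qP] cop by simp
  then consider "int q ^ j dvd f1" | "int q ^ j dvd f2" | "int q ^ j dvd f3"
    using prime_power_dvd_coprime_mult[OF qP cop(3)] by blast
  then show ?thesis
  proof cases
    case 1
    then have "n dvd f1" using f1 coprime_pq by (simp add: divides_mult)
    then obtain g where g: "f1 = n * g" by blast
    have "n * (g * (f2 * f3)) = n * a ^ 3" using prod unfolding g by (simp add: mult_ac)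
    then have e: "g * (f2 * f3) = a ^ 3" using n_pos by (metis less_irrefl mult_cancel_left)
    have "coprime g (f2 * f3)" using cop unfolding g by simp
    then obtain a3 m where a3: "g = a3 ^ 3" and m: "f2 * f3 = m ^ 3" using coprime_mult_cubeD[OF _ e] by blast
    then obtain a1 a2 where a12: "f2 = a1 ^ 3" "f3 = a2 ^ 3" using coprime_mult_cubeD[OF cop(3)] by blast
    have "(a3 * a1 * a2) ^ 3 = a ^ 3" using e unfolding a3 a12 by (simp add: power_mult_distrib mult.assoc)
    then have a: "a = a3 * a1 * a2" using int_cube_inject by metis
    have "a1 ^ 3 + a2 ^ 3 = n * (- a3) ^ 3" using sum unfolding g a3 a12 by simp
    moreover have "\<bar>a1 * a2 * (- a3)\<bar> = \<bar>a\<bar>" unfolding a by (simp add: abs_mult)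
    ultimately show ?thesis by blast
  next
    case 2
    then show ?thesis using no_split_triple[OF sum cop prod f1] by blast
  next
    case 3
    have "f1 + f3 + f2 = 0" "f1 * f3 * f2 = n * a ^ 3" using sum prod by (simp_all add: mult_ac)
    moreover have "coprime f3 f2" using cop by (simp add: coprime_commute)
    ultimately show ?thesis using no_split_triple[of f1 f3 f2 a] cop f1 3 by blast
  qed
qed

lemma triple:
  assumes sum: "f1 + f2 + f3 = 0" and cop: "coprime f1 f2" "coprime f1 f3" "coprime f2 f3"
    and prod: "f1 * f2 * f3 = n * a ^ 3"
  shows "\<exists>a1 a2 a3. a1 ^ 3 + a2 ^ 3 = n * a3 ^ 3 \<and> \<bar>a1 * a2 * a3\<bar> = \<bar>a\<bar>"
proof -
  have "int p ^ i dvd f1 * (f2 * f3)" using prod by (simp add: mult.assoc)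
  then have "int p ^ i dvd f1 \<or> int p ^ i dvd f2 * f3"
    using prime_power_dvd_coprime_mult[OF pP] cop by simp
  then consider "int p ^ i dvd f1" | "int p ^ i dvd f2" | "int p ^ i dvd f3"
    using prime_power_dvd_coprime_mult[OF pP cop(3)] by blast
  then show ?thesis
  proof cases
    case 1
    then show ?thesis using triple_core[OF sum cop prod] by blast
  next
    case 2
    have "f2 + f1 + f3 = 0" "f2 * f1 * f3 = n * a ^ 3" using sum prod by (simp_all add: mult_ac)
    moreover have "coprime f2 f1" using cop by (simp add: coprime_commute)
    ultimately show ?thesis using triple_core[of f2 f1 f3 a] cop 2 by blast
  next
    case 3
    have "f3 + f1 + f2 = 0" "f3 * f1 * f2 = n * a ^ 3" using sum prod by (simp_all add: mult_ac)
    moreover have "coprime f3 f1" "coprime f3 f2" using cop by (simp_all add: coprime_commute)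
    ultimately show ?thesis using triple_core[of f3 f1 f2 a] cop 3 by blast
  qed
qed

section \<open>The descent step\<close>

lemma coprime_norm_not_q:
  assumes "coprime x y" shows "\<not> int q dvd enorm x y"
proof
  assume "int q dvd enorm x y"
  moreover have "q \<noteq> 3" using q3 by (intro notI) simp
  ultimately have "q mod 3 = 1" by (rule prime_dvd_enorm_mod3[OF q assms])
  then show False using q3 by simp
qed

lemma enorm_pos_of_coprime:
  assumes "coprime x y" shows "enorm x y > 0"
  using enorm_nonneg[of x y] coprime_norm_not_q[OF assms] by (cases "enorm x y = 0") auto

text \<open>A common divisor of X + Y and the norm divides 3, so here they are coprime. A norm
  divisible by p would make q a cube modulo p; otherwise X + Y splits into three coprime factors
  with sum zero.\<close>

lemma descent_not_3:
  assumes cop: "coprime X Y" and eq: "X^3 + Y^3 = n * Z^3" and Z: "Z \<noteq> 0" and n3: "\<not> 3 dvd X + Y"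
  shows "\<exists>a1 a2 a3. a1 ^ 3 + a2 ^ 3 = n * a3 ^ 3 \<and> a1 * a2 * a3 \<noteq> 0 \<and> \<bar>a1 * a2 * a3\<bar> \<le> \<bar>Z\<bar>"
proof -
  let ?A = "X + Y" and ?B = "enorm X Y"
  have AB: "?A * ?B = n * Z ^ 3" using enorm_factor eq by simp
  have c3: "coprime ?A 3" using n3 prime_imp_coprime[of 3 ?A] by (simp add: coprime_commute)
  have copAB: "coprime ?A ?B"
  proof (rule coprimeI)
    fix c assume c: "c dvd ?A" "c dvd ?B"
    have "3 * X ^ 2 = ?B - (Y - 2 * X) * ?A" "3 * Y ^ 2 = ?B - (X - 2 * Y) * ?A"
      by (simp_all add: enorm_def algebra_simps power2_eq_square)
    then have "c dvd 3 * X ^ 2" "c dvd 3 * Y ^ 2" using c by simp_all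
    moreover have "coprime (X ^ 2) (Y ^ 2)" using cop by simp
    ultimately have "c dvd 3" using dvd_three_of_coprime by blast
    then show "is_unit c" using c(1) c3 coprime_common_divisor by blast
  qed
  have Bpos: "?B > 0" using enorm_pos_of_coprime[OF cop] .
  have B3: "\<not> 3 dvd ?B" using n3 three_dvd_enorm_iff by blast
  have diff3: "3 dvd X - Y" if "p mod 3 = 1"
    using sum_cubes_three_dvd_diff[OF eq] n_mod_9[OF that] n3 by blast
  from norm_factorization[OF copAB AB Bpos coprime_norm_not_q[OF cop] Z] show ?thesis
  proof cases
    case (2 a b)
    have pm: "p mod 3 = 1" using prime_dvd_enorm_mod3[OF p cop 2(1) p3] .
    have "\<not> 3 dvd b" 
    proof
      assume "3 dvd b"
      then have "(3::int) dvd int b" by presburger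
      then show False using B3 2(2) three_dvd_power_iff[of 3 "int b"] by simp
    qed
    from eis_prime_power_times_cube[OF p pm i cop 2(2) this]
    obtain e r s t F h where *: "e < 3" "eis X Y = omega ^ e * eis r s" "3 dvd s" "\<not> 3 dvd r"
      "int p dvd t^2 + t + 1" "[r + s * t = 0] (mod int p)"
      "[(r - s - s * t) * F ^ 3 = h ^ 3] (mod int p)" "\<not> int p dvd F" by blast
    \<comment> \<open>X \<equiv> Y modulo 3 singles out \<omega>^2.\<close>
    have "e = 2" using omega_exponent_mod3(2)[OF *(1-4)] diff3[OF pm] by blast
    then have XY: "X = s - r" "Y = - r" using eis_omega_mult(3)[of X Y r s] *(2) by simp_all
    \<comment> \<open>As p divides r + s t, X + Y is minus the conjugate r - s - s t modulo p. The
      latter times F^3 is a cube, and X + Y is q^j a^3, so q^j is a cube modulo p.\<close>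
    have "?A + (r - s - s * t) = - (r + s * t)" unfolding XY by simp
    moreover have "int p dvd r + s * t" using *(6) by (simp only: cong_0_iff)
    ultimately have "int p dvd (?A + (r - s - s * t)) * F ^ 3" by (simp only: dvd_minus_iff dvd_mult2)
    moreover have "int p dvd (r - s - s * t) * F ^ 3 - h ^ 3" using *(7) by (simp add: cong_iff_dvd_diff)
    ultimately have "int p dvd (?A + (r - s - s * t)) * F ^ 3 - ((r - s - s * t) * F ^ 3 - h ^ 3)"
      by (rule dvd_diff)
    also have "(?A + (r - s - s * t)) * F ^ 3 - ((r - s - s * t) * F ^ 3 - h ^ 3)
        = ?A * F ^ 3 - (- h) ^ 3" by (simp add: algebra_simps)
    finally have "[int q ^ j * (a * F) ^ 3 = (- h) ^ 3] (mod int p)"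
      unfolding 2(3) by (simp add: cong_iff_dvd_diff power_mult_distrib mult.assoc)
    moreover have "\<not> int p dvd ?A"
      using copAB 2(1) pP coprime_common_divisor not_prime_unit by blast
    then have "\<not> int p dvd a * F" using *(8) pP unfolding 2(3)
      by (auto simp: prime_dvd_mult_iff power3_eq_cube)
    ultimately show ?thesis using not_cube_multiple[OF pm] by blast
  next
    case (1 a b)
    have "\<not> 3 dvd b" 
    proof
      assume "3 dvd b"
      then have "(3::int) dvd int b" by presburger
      then show False using B3 1(1) three_dvd_power_iff[of 3 "int b"] by simp
    qed
    from eis_cube_of_norm_cube[OF cop 1(1) this]
    obtain e u v where e: "e < 3" "eis X Y = omega ^ e * eis u v ^ 3" by blast
    obtain r s where rs: "eis u v ^ 3 = eis r s" using eis_power_ex by blast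
    have N: "?B = enorm u v ^ 3" by (rule enorm_omega_cube[OF e(2)])
    then have "\<not> 3 dvd enorm u v" using B3 three_dvd_power_iff[of 3] by simp
    note rs3 = eis_cube_real_mod3[OF this rs]
    have eis_XY: "eis X Y = omega ^ e * eis r s" using e(2) rs by simp
    have "e = 2"
    proof (cases "p mod 3 = 1")
      case True
      then show ?thesis using omega_exponent_mod3(2)[OF e(1) eis_XY rs3] diff3 by blast
    next
      case False
      \<comment> \<open>p divides X + Y here, so an exponent below 2 would make p divide the norm
        too.\<close>
      then have p9: "p mod 9 = 2 \<or> p mod 9 = 5" using p_type by blast
      show ?thesis
      proof (rule ccontr)
        assume "e \<noteq> 2"
        then have "e < 2" using e(1) by simp
        have pA: "int p dvd ?A" unfolding 1(2) using i by (simp add: dvd_mult2 dvd_power)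
        from inert_prime_dvd_norm[OF p p9 e(2) \<open>e < 2\<close> this] have "int p dvd ?B"
          unfolding N by (simp add: power3_eq_cube)
        then show False using copAB pA pP coprime_common_divisor not_prime_unit by blast
      qed
    qed
    then have XY: "X = s - r" "Y = - r" using eis_omega_mult(3)[of X Y r s] eis_XY by simp_all
    have rs': "r = u^3 + v^3 - 3*u*v^2" "s = 3*u*v*(u-v)" using rs unfolding eis_cube by auto
    \<comment> \<open>With \<beta> = u + v \<omega>, X + Y is minus the trace of \<beta>^3; the
      three forms are the traces of \<beta>, \<omega>^2 \<beta> and \<omega> \<beta>, hence sum to
      zero.\<close>
    let ?f1 = "2*u - v" and ?f2 = "2*v - u" and ?f3 = "- (u + v)"
    have A: "?A = - (?f1 * ?f2 * ?f3)"
      unfolding XY rs' by (simp add: algebra_simps power2_eq_square power3_eq_cube)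
    have copuv: "coprime u v" by (rule coprime_of_coprime_cube[OF e(2) cop])
    have unit: "is_unit c" if "c dvd 3 * u" "c dvd 3 * v" "c dvd ?A" for c
      using dvd_three_of_coprime[OF copuv that(1,2)] that(3) c3 coprime_common_divisor by blast
    have c12: "coprime ?f1 ?f2"
    proof (rule coprimeI)
      fix c assume c: "c dvd ?f1" "c dvd ?f2"
      have "3 * u = 2 * ?f1 + ?f2" "3 * v = ?f1 + 2 * ?f2" by simp_all
      then have "c dvd 3 * u" "c dvd 3 * v" using c by (metis dvd_add dvd_mult)+
      moreover have "c dvd ?A" unfolding A using c by simp
      ultimately show "is_unit c" by (rule unit)
    qed
    have c13: "coprime ?f1 ?f3"
    proof (rule coprimeI)
      fix c assume c: "c dvd ?f1" "c dvd ?f3"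
      have "3 * u = ?f1 - ?f3" "3 * v = - 2 * ?f3 - ?f1" by simp_all
      then have "c dvd 3 * u" "c dvd 3 * v" using c by (metis dvd_diff dvd_mult)+
      moreover have "c dvd ?A" unfolding A using c by simp
      ultimately show "is_unit c" by (rule unit)
    qed
    have c23: "coprime ?f2 ?f3"
    proof (rule coprimeI)
      fix c assume c: "c dvd ?f2" "c dvd ?f3"
      have "3 * v = ?f2 - ?f3" "3 * u = - 2 * ?f3 - ?f2" by simp_all
      then have "c dvd 3 * u" "c dvd 3 * v" using c by (metis dvd_diff dvd_mult)+
      moreover have "c dvd ?A" unfolding A using c by simp
      ultimately show "is_unit c" by (rule unit)
    qed
    have "?f1 * ?f2 * ?f3 = n * (- a) ^ 3" using A 1(2) by simp
    from triple[OF _ c12 c13 c23 this]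
    obtain a1 a2 a3 where a: "a1 ^ 3 + a2 ^ 3 = n * a3 ^ 3" "\<bar>a1 * a2 * a3\<bar> = \<bar>a\<bar>" by auto
    have "b \<noteq> 0" "a \<noteq> 0" using Z 1(3) by auto
    then have "\<bar>a\<bar> \<le> \<bar>Z\<bar>" unfolding 1(3) by (simp add: abs_mult)
    then show ?thesis using a \<open>a \<noteq> 0\<close> by (metis abs_eq_0)
  qed
qed

text \<open>Since 3 divides the norm, 1 - \<omega> is taken out of X + Y \<omega>, leaving r + s
  \<omega> with s = (X + Y)/3. Then 3 divides Z and s, and s/3 takes the role of X + Y.\<close>

lemma descent_3:
  assumes cop: "coprime X Y" and eq: "X^3 + Y^3 = n * Z^3" and Z: "Z \<noteq> 0" and d3: "3 dvd X + Y"
  shows "\<exists>a1 a2 a3. a1 ^ 3 + a2 ^ 3 = n * a3 ^ 3 \<and> a1 * a2 * a3 \<noteq> 0 \<and> \<bar>a1 * a2 * a3\<bar> \<le> \<bar>Z\<bar>"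
proof -
  obtain s where s: "X + Y = 3 * s" using d3 by blast
  define r where "r = X - s"
  have XY: "X = r + s" "Y = 2 * s - r" using s by (simp_all add: r_def)
  have eis_XY: "eis X Y = eis 1 (-1) * eis r s" unfolding XY by (simp add: eis_mult)
  have coprs: "coprime r s" by (rule coprime_eis_factor[OF eis_XY cop])
  have "enorm X Y = 3 * enorm r s" using enorm_mult[OF eis_XY] by (simp add: enorm_def)
  then have e1: "9 * (s * enorm r s) = n * Z ^ 3" using enorm_factor[of X Y] eq s by simp
  then have "n * Z ^ 3 = 3 * (3 * (s * enorm r s))" by simp
  then have "3 dvd n * Z ^ 3" by (rule dvdI)
  then have "3 dvd Z" using not_3_dvd_n three_dvd_prod_iff three_dvd_power_iff by auto
  then obtain Z1 where Z1: "Z = 3 * Z1" by blast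
  have e2: "s * enorm r s = 3 * (n * Z1 ^ 3)" using e1 unfolding Z1 by (simp add: power_mult_distrib)
  have X3: "\<not> 3 dvd X"
  proof
    assume "3 dvd X"
    then have "3 dvd Y" using d3 by (simp add: dvd_add_right_iff)
    with \<open>3 dvd X\<close> cop have "is_unit (3::int)" using coprime_common_divisor by blast
    then show False by simp
  qed
  have N3: "\<not> 3 dvd enorm r s" using X3 three_dvd_enorm_iff[of r s] XY by simp
  have "3 dvd s * enorm r s" unfolding e2 by simp
  then have s3: "3 dvd s" using N3 three_dvd_prod_iff by blast
  then obtain s1 where s1: "s = 3 * s1" by blast
  have r3: "\<not> 3 dvd r" using X3 XY(1) s3 by (metis dvd_add)
  have AB: "s1 * enorm r s = n * Z1 ^ 3" using e2 unfolding s1 by simp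
  have copAB: "coprime s1 (enorm r s)"
  proof (rule coprimeI)
    fix c assume c: "c dvd s1" "c dvd enorm r s"
    then have cs: "c dvd s" using s1 by simp
    have "r ^ 2 = enorm r s - (s - r) * s" by (simp add: enorm_def algebra_simps power2_eq_square)
    then have "c dvd r ^ 2" using c cs by simp
    moreover have "coprime (r ^ 2) s" using coprs by simp
    ultimately show "is_unit c" using cs coprime_common_divisor by blast
  qed
  have Z10: "Z1 \<noteq> 0" using Z Z1 by simp
  from norm_factorization[OF copAB AB enorm_pos_of_coprime[OF coprs] coprime_norm_not_q[OF coprs] Z10]
  show ?thesis
  proof cases
    case (2 a b)
    have pm: "p mod 3 = 1" using prime_dvd_enorm_mod3[OF p coprs 2(1) p3] .
    have "\<not> 3 dvd b" 
    proof
      assume "3 dvd b"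
      then have "(3::int) dvd int b" by presburger
      then show False using N3 2(2) three_dvd_power_iff[of 3 "int b"] by simp
    qed
    from eis_prime_power_times_cube[OF p pm i coprs 2(2) this]
    obtain e r' s' t F h where *: "e < 3" "eis r s = omega ^ e * eis r' s'" "3 dvd s'" "\<not> 3 dvd r'"
      "int p dvd t^2 + t + 1" "[r' + s' * t = 0] (mod int p)"
      "[(r' - s' - s' * t) * F ^ 3 = h ^ 3] (mod int p)" "\<not> int p dvd F" by blast
    have "e = 0" using omega_exponent_mod3(1)[OF *(1-4)] s3 by blast
    then have rs': "r' = r" "s' = s" using *(2) by simp_all
    obtain k where k: "t^2 + t + 1 = int p * k" using *(5) by blast
    obtain l where l: "r + s * t = int p * l" using *(6) unfolding rs' cong_0_iff by blast
    \<comment> \<open>w is a square root of -3 modulo p. The conjugate is (r + s t) - s w with s = 3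
      q^j a^3, and -3w is w^3, so it is q^j times a cube.\<close>
    let ?w = "2 * t + 1"
    have w2: "?w ^ 2 = 4 * (int p * k) - 3" unfolding k[symmetric] by (simp add: algebra_simps power2_eq_square)
    have sa: "s = 3 * (int q ^ j * a ^ 3)" using s1 2(3) by simp
    have "(r - s - s * t) - int q ^ j * (a * ?w) ^ 3
        = (r + s * t) - s * ?w - int q ^ j * a ^ 3 * (?w ^ 2 * ?w)"
      by (simp add: algebra_simps power2_eq_square power3_eq_cube)
    also have "\<dots> = int p * (l - 4 * k * int q ^ j * a ^ 3 * ?w)"
      unfolding l w2 by (subst sa) (simp add: algebra_simps)
    finally have "[r - s - s * t = int q ^ j * (a * ?w) ^ 3] (mod int p)"
      by (simp add: cong_iff_dvd_diff)
    from cong_scalar_right[OF this, of "F ^ 3"]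
    have "[(r - s - s * t) * F ^ 3 = int q ^ j * (a * ?w * F) ^ 3] (mod int p)"
      by (simp only: power_mult_distrib mult.assoc)
    from cong_trans[OF cong_sym[OF this] *(7)[unfolded rs']]
    have "[int q ^ j * (a * ?w * F) ^ 3 = h ^ 3] (mod int p)" .
    moreover have "\<not> int p dvd a * ?w * F"
    proof -
      have "\<not> int p dvd s1"
        using copAB 2(1) pP coprime_common_divisor not_prime_unit by blast
      then have "\<not> int p dvd a" unfolding 2(3) by (auto simp: power3_eq_cube)
      moreover have "\<not> int p dvd ?w"
      proof
        assume "int p dvd ?w"
        then have "int p dvd ?w ^ 2" by (simp add: power2_eq_square)
        then have "int p dvd 4 * (int p * k) - ?w ^ 2" by (intro dvd_diff) simp_all
        then have "int p dvd int 3" unfolding w2 by simp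
        then have "p dvd 3" by (simp only: int_dvd_int_iff)
        then show False using primes_dvd_imp_eq[of p 3] p p3 by simp
      qed
      ultimately show ?thesis using *(8) pP by (simp add: prime_dvd_mult_iff)
    qed
    ultimately show ?thesis using not_cube_multiple[OF pm] by blast
  next
    case (1 a b)
    have "\<not> 3 dvd b" 
    proof
      assume "3 dvd b"
      then have "(3::int) dvd int b" by presburger
      then show False using N3 1(1) three_dvd_power_iff[of 3 "int b"] by simp
    qed
    from eis_cube_of_norm_cube[OF coprs 1(1) this]
    obtain e u v where e: "e < 3" "eis r s = omega ^ e * eis u v ^ 3" by blast
    obtain r' s' where rs: "eis u v ^ 3 = eis r' s'" using eis_power_ex by blast
    have "enorm r s = enorm u v ^ 3" by (rule enorm_omega_cube[OF e(2)])
    then have "\<not> 3 dvd enorm u v" using N3 three_dvd_power_iff[of 3] by simp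
    note rs3 = eis_cube_real_mod3[OF this rs]
    have eis_rs: "eis r s = omega ^ e * eis r' s'" using e(2) rs by simp
    have "e = 0" using omega_exponent_mod3(1)[OF e(1) eis_rs rs3] s3 by blast
    then have "s' = s" using eis_rs by simp
    \<comment> \<open>s is the \<omega>-coordinate of a cube; its factors yield v, u - v and -u,
      coprime with sum zero.\<close>
    then have "s = 3*u*v*(u-v)" using rs unfolding eis_cube by auto
    then have A: "s1 = u * v * (u - v)" using s1 by simp
    have copuv: "coprime u v" by (rule coprime_of_coprime_cube[OF e(2) coprs])
    have c1: "coprime v (u - v)"
    proof (rule coprimeI)
      fix c assume "c dvd v" "c dvd u - v"
      then have "c dvd u" by (metis dvd_add diff_add_cancel)
      then show "is_unit c" using \<open>c dvd v\<close> copuv coprime_common_divisor by blast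
    qed
    have c2: "coprime (u - v) (- u)"
    proof (rule coprimeI)
      fix c assume "c dvd u - v" "c dvd - u"
      then have "c dvd u" by simp
      then have "c dvd u - (u - v)" using \<open>c dvd u - v\<close> by (rule dvd_diff)
      then have "c dvd v" by simp
      then show "is_unit c" using \<open>c dvd u\<close> copuv coprime_common_divisor by blast
    qed
    have c3: "coprime v (- u)" using copuv by (simp add: coprime_commute)
    have "v * (u - v) * (- u) = n * (- a) ^ 3" using A 1(2) by (simp add: algebra_simps)
    from triple[OF _ c1 c3 c2 this]
    obtain a1 a2 a3 where a: "a1 ^ 3 + a2 ^ 3 = n * a3 ^ 3" "\<bar>a1 * a2 * a3\<bar> = \<bar>a\<bar>" by auto
    have "b \<noteq> 0" "a \<noteq> 0" using Z10 1(3) by auto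
    then have "\<bar>a\<bar> \<le> \<bar>Z1\<bar>" unfolding 1(3) by (simp add: abs_mult)
    then have "\<bar>a\<bar> \<le> \<bar>Z\<bar>" unfolding Z1 by simp
    then show ?thesis using a \<open>a \<noteq> 0\<close> by (metis abs_eq_0)
  qed
qed

section \<open>Infinite descent on |Z|\<close>

lemma prime_cube_dvd_imp_dvd:
  fixes g :: int
  assumes g: "prime g" and dvd: "g ^ 3 dvd n * Z ^ 3"
  shows "g dvd Z"
proof (rule ccontr)
  assume "\<not> g dvd Z"
  then have "coprime (g ^ 3) (Z ^ 3)" using g by (simp add: prime_imp_coprime)
  then have "g ^ 3 dvd n" using dvd by (simp add: coprime_dvd_mult_left_iff)
  moreover obtain m where m: "g = int m" using g by (metis prime_ge_0_int nonneg_int_cases)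
  ultimately have "int (m ^ 3) dvd int (p ^ i * q ^ j)" by simp
  then have "m ^ 3 dvd p ^ i * q ^ j" by (simp only: int_dvd_int_iff)
  then show False using cubefree[of m] g m by simp
qed

text \<open>A common prime of X and Y is divided out, n being cube-free. In the coprime case the new
  solution has product of entries at most |Z|; if its last entry is not smaller than |Z|, the other
  two are 1 or -1, impossible for n > 2.\<close>

theorem no_cube_sum: "X^3 + Y^3 = n * Z^3 \<Longrightarrow> Z = 0"
proof (induction "nat \<bar>Z\<bar>" arbitrary: X Y Z rule: less_induct)
  case less
  show ?case
  proof (rule ccontr)
    assume Z: "Z \<noteq> 0"
    show False
    proof (cases "coprime X Y")
      case False
      have "gcd X Y \<noteq> 0"
      proof
        assume "gcd X Y = 0"
        then have "n * Z ^ 3 = 0" using less.prems by simp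
        then show False using Z n_pos by simp
      qed
      then obtain g where g: "prime g" "g dvd gcd X Y"
        using False prime_divisor_exists[of "gcd X Y"] by (metis coprime_iff_gcd_eq_1 is_unit_gcd)
      then have "g dvd X" "g dvd Y" by (meson dvd_trans gcd_dvd1 gcd_dvd2)+
      then obtain X1 Y1 where 1: "X = g * X1" "Y = g * Y1" by blast
      have "n * Z ^ 3 = g ^ 3 * (X1 ^ 3 + Y1 ^ 3)"
        unfolding less.prems[symmetric] 1 by (simp add: power_mult_distrib algebra_simps)
      then have "g dvd Z" using prime_cube_dvd_imp_dvd[OF g(1)] by simp
      then obtain Z1 where Z1: "Z = g * Z1" by blast
      have "g ^ 3 * (X1 ^ 3 + Y1 ^ 3) = g ^ 3 * (n * Z1 ^ 3)"
        using less.prems unfolding 1 Z1 by (simp add: power_mult_distrib algebra_simps)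
      then have "X1 ^ 3 + Y1 ^ 3 = n * Z1 ^ 3" using g(1) by auto
      moreover have "nat \<bar>Z1\<bar> < nat \<bar>Z\<bar>"
      proof -
        have "g > 1" using g(1) by (rule prime_gt_1_int)
        moreover have "\<bar>Z1\<bar> > 0" using Z Z1 by simp
        ultimately have "1 * \<bar>Z1\<bar> < g * \<bar>Z1\<bar>" by (intro mult_strict_right_mono)
        then show ?thesis using Z1 \<open>g > 1\<close> by (simp add: abs_mult)
      qed
      ultimately have "Z1 = 0" using less.hyps by blast
      then show False using Z Z1 by simp
    next
      case True
      then obtain a1 a2 a3 where a: "a1 ^ 3 + a2 ^ 3 = n * a3 ^ 3" "a1 * a2 * a3 \<noteq> 0"
        "\<bar>a1 * a2 * a3\<bar> \<le> \<bar>Z\<bar>"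
        using descent_3[OF _ less.prems Z] descent_not_3[OF _ less.prems Z] by blast
      have a0: "a1 \<noteq> 0" "a2 \<noteq> 0" "a3 \<noteq> 0" using a(2) by auto
      have "\<not> \<bar>a3\<bar> < \<bar>Z\<bar>"
      proof
        assume "\<bar>a3\<bar> < \<bar>Z\<bar>"
        then have "a3 = 0" using less.hyps[OF _ a(1)] by simp
        then show False using a0 by simp
      qed
      then have "\<bar>a1 * a2\<bar> * \<bar>a3\<bar> \<le> 1 * \<bar>a3\<bar>" using a(3) by (simp add: abs_mult)
      then have "\<bar>a1 * a2\<bar> \<le> 1" using a0 by (simp only: mult_le_cancel_right)
      moreover have "\<bar>a1 * a2\<bar> > 0" using a0 by simp
      ultimately have "\<bar>a1 * a2\<bar> = 1" by linarith
      then have "a1 * a2 dvd 1" by simp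
      then have "a1 dvd 1" "a2 dvd 1" by (meson dvd_mult_left dvd_mult_right)+
      then have "a1 = 1 \<or> a1 = -1" "a2 = 1 \<or> a2 = -1" by (auto simp: abs_if split: if_splits)
      then have "a1 ^ 3 + a2 ^ 3 \<in> {-2, 0, 2}" by auto
      then have "\<bar>n * a3 ^ 3\<bar> \<le> 2" unfolding a(1) by auto
      moreover have "\<bar>a3 ^ 3\<bar> \<ge> 1" using a0 by (simp add: int_one_le_iff_zero_less)
      then have "n * 1 \<le> n * \<bar>a3 ^ 3\<bar>" using n_pos by (intro mult_left_mono) auto
      then have "n \<le> \<bar>n * a3 ^ 3\<bar>" using n_pos by (simp only: abs_mult[of n "a3 ^ 3"] abs_of_pos[OF n_pos] mult_1_right)
      ultimately show False using n_gt_2 by linarith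
    qed
  qed
qed

end

section \<open>Rational points\<close>

text \<open>The classical map from the curve to u^3 + v^3 = n, then clearing denominators. It is
  defined since x = 0 would make y^2 negative.\<close>

lemma no_affine_point_of_no_cube_sum:
  fixes n :: nat
  assumes n: "n > 0" and no: "\<And>X Y Z :: int. X^3 + Y^3 = int n * Z^3 \<Longrightarrow> Z = 0"
  shows "\<not> on_curve (- 432 * (int n)^2) (Pt x y)"
proof
  assume "on_curve (- 432 * (int n)^2) (Pt x y)"
  then have xy: "y^2 = x^3 - 432 * (of_nat n)^2" by (simp add: on_curve_def)
  have x0: "x \<noteq> 0"
  proof
    assume "x = 0"
    then have "y^2 = - (432 * (of_nat n)^2)" using xy by simp
    moreover have "(432 * (of_nat n)^2 :: rat) > 0" using n by simp
    ultimately show False using zero_le_power2[of y] by linarith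
  qed
  define N :: rat where "N = of_nat n"
  \<comment> \<open>The constants make the cubed numerators add up to 216 n (432 n^2 + y^2), which
    is n (6x)^3 on the curve.\<close>
  define u v where "u = (36 * N + y) / (6 * x)" and "v = (36 * N - y) / (6 * x)"
  have "(36 * N + y)^3 + (36 * N - y)^3 = 216 * N * (432 * N^2 + y^2)"
    by (simp add: power2_eq_square power3_eq_cube algebra_simps)
  also have "\<dots> = N * (6 * x)^3" using xy by (simp add: N_def power_mult_distrib)
  finally have sum: "(36 * N + y)^3 + (36 * N - y)^3 = N * (6 * x)^3" .
  have "u^3 + v^3 = ((36 * N + y)^3 + (36 * N - y)^3) / (6 * x)^3"
    unfolding u_def v_def power_divide by (rule add_divide_distrib[symmetric])
  also have "\<dots> = N" unfolding sum using x0 by simp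
  finally have uv: "u^3 + v^3 = N" .
  have frac: "\<exists>a b. b \<noteq> 0 \<and> r * of_int b = of_int a" for r :: rat
  proof -
    obtain a b where "r = Fract a b" "b > 0" by (rule Rat_cases)
    then show ?thesis by (intro exI[of _ a] exI[of _ b]) (simp add: Fract_of_int_quotient)
  qed
  obtain a b where ab: "b \<noteq> 0" "u * of_int b = of_int a" using frac by blast
  obtain c d where cd: "d \<noteq> 0" "v * of_int d = of_int c" using frac by blast
  have "(of_int a * of_int d)^3 + (of_int c * of_int b)^3 = (u^3 + v^3) * (of_int b * of_int d :: rat)^3"
    unfolding ab(2)[symmetric] cd(2)[symmetric] by (simp add: power_mult_distrib algebra_simps)
  also have "\<dots> = N * (of_int b * of_int d)^3" unfolding uv ..
  finally have "(of_int ((a * d)^3 + (c * b)^3) :: rat) = of_int (int n * (b * d)^3)"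
    by (simp add: N_def)
  then have "(a * d)^3 + (c * b)^3 = int n * (b * d)^3" by (simp only: of_int_eq_iff)
  then have "b * d = 0" by (rule no)
  then show False using ab cd by simp
qed

text \<open>All points are \<open>Inf\<close>, so in a nonempty list the head with coefficient 1 is
  already a nontrivial relation.\<close>

lemma mw_rank_eq_0_of_no_affine_point:
  assumes "\<And>x y. \<not> on_curve m (Pt x y)"
  shows "mw_rank m = 0"
proof -
  have "ps = []" if ind: "ec_independent m ps" for ps
  proof (cases ps)
    case (Cons P qs)
    have Inf: "Q = Inf" if "Q \<in> set ps" for Q
    proof -
      have "on_curve m Q" using that ind unfolding ec_independent_def by blast
      then show ?thesis by (cases Q) (simp_all add: assms)
    qed
    have zero: "ec_lincomb (replicate (length ps') (0::int)) ps' = Inf" for ps'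
      by (induction ps') (simp_all add: ec_lincomb_def ec_mul_def)
    have "ec_lincomb (1 # replicate (length qs) 0) ps = ec_add (ec_mul 1 P) (ec_lincomb (replicate (length qs) 0) qs)"
      unfolding Cons by (simp add: ec_lincomb_def)
    also have "\<dots> = Inf" unfolding zero using Inf[of P] Cons by (simp add: ec_mul_def)
    finally have "\<forall>c\<in>set (1 # replicate (length qs) (0::int)). c = 0"
      using ind Cons unfolding ec_independent_def by (metis length_Cons length_replicate)
    then show ?thesis by simp
  qed
  then have "{enat (length ps) | ps. ec_independent m ps} \<subseteq> {0}" by (auto simp: zero_enat_def)
  then have "Sup {enat (length ps) | ps. ec_independent m ps} \<le> Sup {0}" by (rule Sup_subset_mono)
  then show ?thesis unfolding mw_rank_def by simp
qed

section \<open>The ternary obstructions and the four cases\<close>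

lemma no_ternary_mod_9:
  fixes x y z :: int
  assumes cop: "coprime x (int p * y)"
    and "(int p ^ i mod 9, int q ^ j mod 9) \<in> {(2,5),(4,7),(4,2),(7,5)}"
  shows "x^3 + int p ^ i * y^3 + int q ^ j * z^3 \<noteq> 0"
proof
  assume "x^3 + int p ^ i * y^3 + int q ^ j * z^3 = 0"
  from ternary_mod_9[OF this assms(2)] have "3 dvd x" "3 dvd int p * y" by auto
  then have "is_unit (3::int)" using cop coprime_common_divisor by blast
  then show False by simp
qed

text \<open>Modulo p the equation makes q^j z^3 a cube, hence q too, since coprimality keeps p from
  dividing z.\<close>

lemma no_ternary_mod_p:
  fixes x y z :: int
  assumes p: "prime p" and q: "\<not> p dvd q" and i: "i > 0" and j: "j = 1 \<or> j = 2"
    and noncube: "\<not> (\<exists>x::nat. [x^3 = q] (mod p))"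
    and cop: "coprime (int p * y) (int q * z)"
  shows "x^3 + int p ^ i * y^3 + int q ^ j * z^3 \<noteq> 0"
proof
  assume "x^3 + int p ^ i * y^3 + int q ^ j * z^3 = 0"
  then have "int q ^ j * z^3 - (- x)^3 = int p ^ i * (- (y^3))" by (simp add: algebra_simps)
  moreover have "int p dvd int p ^ i" using i by (simp add: dvd_power)
  ultimately have "[int q ^ j * z^3 = (- x)^3] (mod int p)"
    unfolding cong_iff_dvd_diff by (metis dvd_mult2)
  moreover have "\<not> int p dvd z"
  proof
    assume "int p dvd z"
    then have "int p dvd int q * z" by simp
    then have "is_unit (int p)" using cop coprime_common_divisor by (meson dvd_triv_left)
    then show False using p by simp
  qed
  ultimately show False using cubic_residue_of_power[OF p j q] noncube by blast
qed

theorem theorem3p1: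
  fixes n l1 l2 :: nat
  assumes "n > 0"
    and "\<forall>p. prime p \<longrightarrow> \<not> p^3 dvd n"
    and "coprime n 3"
    and "prime l1" and "prime l2" and "l1 \<noteq> l2"
    and "prime_factors n = {l1, l2}"
    and "((n = l1 * l2 \<or> n = l1^2 * l2^2) \<and> l1 mod 9 = 2 \<and> l2 mod 9 = 5)
       \<or> (n = l1^2 * l2 \<and> ((l1 mod 9 = 2 \<and> l2 mod 9 = 2) \<or> (l1 mod 9 = 5 \<and> l2 mod 9 = 5)))
       \<or> ((n = l1 * l2 \<or> n = l1^2 * l2) \<and> (n mod 9 = 2 \<or> n mod 9 = 5) \<and>
          l1 mod 3 = 1 \<and> l2 mod 3 = 2 \<and> \<not> (\<exists>x::nat. [x^3 = l2] (mod l1)))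
       \<or> ((n = l1^2 * l2^2 \<or> n = l1 * l2^2) \<and> (n mod 9 = 4 \<or> n mod 9 = 7) \<and>
          l1 mod 3 = 1 \<and> l2 mod 3 = 2 \<and> \<not> (\<exists>x::nat. [x^3 = l2] (mod l1)))"
  shows "mw_rank (- 432 * (int n)^2) = 0"
proof -
  \<comment> \<open>Case (1) yields the pairs (2,5) and (4,7), case (2) the pairs (4,2) and (7,5);
    cases (3) and (4) yield the second alternative.\<close>
  obtain i j :: nat where ij: "i = 1 \<or> i = 2" "j = 1 \<or> j = 2" "n = l1 ^ i * l2 ^ j"
    and types: "(l1 mod 9 = 2 \<or> l1 mod 9 = 5) \<and> l2 mod 3 = 2 \<and>
        (int l1 ^ i mod 9, int l2 ^ j mod 9) \<in> {(2,5),(4,7),(4,2),(7,5)} \<or>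
      l1 mod 3 = 1 \<and> l2 mod 3 = 2 \<and> \<not> (\<exists>x::nat. [x^3 = l2] (mod l1)) \<and> n mod 9 \<noteq> 1 \<and> n mod 9 \<noteq> 8"
  proof -
    note thesisI = that
    have mod_3: "l mod 3 = 2" if "l mod 9 = 2 \<or> l mod 9 = 5" for l :: nat using that by presburger
    have first: thesis
      if l: "l1 mod 9 = a" "l2 mod 9 = b" "a = 2 \<or> a = 5" "b = 2 \<or> b = 5"
        and ef: "e = 1 \<or> e = 2" "f = 1 \<or> f = 2" "n = l1 ^ e * l2 ^ f"
        and S: "(int (a ^ e mod 9), int (b ^ f mod 9)) \<in> {(2,5),(4,7),(4,2),(7,5)}"
      for a b e f :: nat
    proof (rule thesisI[OF ef disjI1])
      have "(int l1 ^ e mod 9, int l2 ^ f mod 9) = (int (a ^ e mod 9), int (b ^ f mod 9))"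
        unfolding l(1,2)[symmetric] by (simp add: zmod_int power_mod)
      then have "(int l1 ^ e mod 9, int l2 ^ f mod 9) \<in> {(2,5),(4,7),(4,2),(7,5)}"
        using S by (simp only:)
      then show "(l1 mod 9 = 2 \<or> l1 mod 9 = 5) \<and> l2 mod 3 = 2 \<and>
          (int l1 ^ e mod 9, int l2 ^ f mod 9) \<in> {(2,5),(4,7),(4,2),(7,5)}"
        using mod_3[of l2] l by (intro conjI) simp_all
    qed
    have second: thesis
      if l: "l1 mod 3 = 1 \<and> l2 mod 3 = 2 \<and> \<not> (\<exists>x::nat. [x^3 = l2] (mod l1))"
        and n: "n mod 9 \<noteq> 1" "n mod 9 \<noteq> 8"
        and ef: "e = 1 \<or> e = 2" "f = 1 \<or> f = 2" "n = l1 ^ e * l2 ^ f" for e f :: nat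
      by (rule thesisI[OF ef disjI2]) (use l n in \<open>simp only: simp_thms\<close>)
    show ?thesis
      using assms(8)
    proof (elim disjE)
      assume "(n = l1 * l2 \<or> n = l1^2 * l2^2) \<and> l1 mod 9 = 2 \<and> l2 mod 9 = 5"
      then have n: "n = l1 ^ 1 * l2 ^ 1 \<or> n = l1 ^ 2 * l2 ^ 2" and l: "l1 mod 9 = 2" "l2 mod 9 = 5"
        unfolding power_one_right by blast+
      from n show ?thesis
      proof
        assume "n = l1 ^ 1 * l2 ^ 1"
        from first[OF l _ _ _ _ this] show ?thesis by simp
      next
        assume "n = l1 ^ 2 * l2 ^ 2"
        from first[OF l _ _ _ _ this] show ?thesis by simp
      qed
    next
      assume "n = l1^2 * l2 \<and> ((l1 mod 9 = 2 \<and> l2 mod 9 = 2) \<or> (l1 mod 9 = 5 \<and> l2 mod 9 = 5))"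
      then have n: "n = l1 ^ 2 * l2 ^ 1"
        and l: "(l1 mod 9 = 2 \<and> l2 mod 9 = 2) \<or> (l1 mod 9 = 5 \<and> l2 mod 9 = 5)"
        unfolding power_one_right by blast+
      from l show ?thesis
      proof (elim disjE conjE)
        assume "l1 mod 9 = 2" "l2 mod 9 = 2"
        from first[OF this _ _ _ _ n] show ?thesis by simp
      next
        assume "l1 mod 9 = 5" "l2 mod 9 = 5"
        from first[OF this _ _ _ _ n] show ?thesis by simp
      qed
    next
      assume "(n = l1 * l2 \<or> n = l1^2 * l2) \<and> (n mod 9 = 2 \<or> n mod 9 = 5) \<and>
          l1 mod 3 = 1 \<and> l2 mod 3 = 2 \<and> \<not> (\<exists>x::nat. [x^3 = l2] (mod l1))"
      then have n: "n = l1 ^ 1 * l2 ^ 1 \<or> n = l1 ^ 2 * l2 ^ 1" "n mod 9 = 2 \<or> n mod 9 = 5"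
        and l: "l1 mod 3 = 1 \<and> l2 mod 3 = 2 \<and> \<not> (\<exists>x::nat. [x^3 = l2] (mod l1))"
        unfolding power_one_right by blast+
      have "n mod 9 \<noteq> 1" "n mod 9 \<noteq> 8" using n(2) by auto
      note sec = second[OF l this]
      from n(1) show ?thesis
      proof
        assume "n = l1 ^ 1 * l2 ^ 1"
        from sec[OF _ _ this] show ?thesis by simp
      next
        assume "n = l1 ^ 2 * l2 ^ 1"
        from sec[OF _ _ this] show ?thesis by simp
      qed
    next
      assume "(n = l1^2 * l2^2 \<or> n = l1 * l2^2) \<and> (n mod 9 = 4 \<or> n mod 9 = 7) \<and>
          l1 mod 3 = 1 \<and> l2 mod 3 = 2 \<and> \<not> (\<exists>x::nat. [x^3 = l2] (mod l1))"
      then have n: "n = l1 ^ 2 * l2 ^ 2 \<or> n = l1 ^ 1 * l2 ^ 2" "n mod 9 = 4 \<or> n mod 9 = 7"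
        and l: "l1 mod 3 = 1 \<and> l2 mod 3 = 2 \<and> \<not> (\<exists>x::nat. [x^3 = l2] (mod l1))"
        unfolding power_one_right by blast+
      have "n mod 9 \<noteq> 1" "n mod 9 \<noteq> 8" using n(2) by auto
      note sec = second[OF l this]
      from n(1) show ?thesis
      proof
        assume "n = l1 ^ 2 * l2 ^ 2"
        from sec[OF _ _ this] show ?thesis by simp
      next
        assume "n = l1 ^ 1 * l2 ^ 2"
        from sec[OF _ _ this] show ?thesis by simp
      qed
    qed
  qed
  have l12: "\<not> l1 dvd l2" using primes_dvd_imp_eq assms(4-6) by blast
  interpret cube_sum l1 l2 i j
  proof
    show "l1 \<noteq> 3" using types by auto
    show "l2 mod 3 = 2" using types by blast
    show "i > 0" using ij by auto
    show "\<not> g ^ 3 dvd l1 ^ i * l2 ^ j" if "prime g" for g using that assms(2) ij(3) by blast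
    show "x^3 + int l1 ^ i * y^3 + int l2 ^ j * z^3 \<noteq> 0"
      if "coprime x (int l1 * y)" "coprime x (int l2 * z)" "coprime (int l1 * y) (int l2 * z)"
      for x y z :: int
      using types
    proof (elim disjE conjE)
      assume "\<not> (\<exists>x::nat. [x^3 = l2] (mod l1))"
      then show ?thesis using no_ternary_mod_p[OF assms(4) l12 _ ij(2) _ that(3)] ij(1) by auto
    qed (rule no_ternary_mod_9[OF that(1)], assumption)+
    show "l1 mod 9 = 2 \<or> l1 mod 9 = 5 \<or> l1 mod 3 = 1 \<and> \<not> (\<exists>x::nat. [x^3 = l2] (mod l1)) \<and>
      (l1 ^ i * l2 ^ j) mod 9 \<noteq> 1 \<and> (l1 ^ i * l2 ^ j) mod 9 \<noteq> 8"
      using types unfolding ij(3)[symmetric] by (elim disjE conjE) simp_all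
  qed (use assms ij in auto)
  have "X^3 + Y^3 = int n * Z^3 \<Longrightarrow> Z = 0" for X Y Z :: int
    using no_cube_sum[of X Y Z] by (simp add: ij(3))
  then show ?thesis
    by (intro mw_rank_eq_0_of_no_affine_point no_affine_point_of_no_cube_sum assms(1))
qed

end
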